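(* Let $m$ be a positive integer and let $\{T(t)\}_{t\ge 0}$ be a $C_0$-semigroup on a separable complex Hilbert space $H$, with infinitesimal generator $A$. Then the following conditions are equivalent: (i) $T(t)$ is an $m$-isometry for every $t\ge 0$. (ii) For each $x\in H$, the mapping $t\in[0,\infty)\mapsto \|T(t)x\|^2$ is a polynomial of degree less than $m$. (iii) $\displaystyle\sum_{k=0}^m \binom{m}{k}\langle A^{m-k}x, A^{k}x\rangle=0$ for every $x\in D(A^m)$. (iv) The cogenerator $V$ of $\{T(t)\}_{t\ge 0}$ exists and is an $m$-isometry.
   Context: A $C_0$-semigroup on $H$ is a family $\{T(t)\}_{t\ge0}$ of bounded linear operators on $H$ with $T(0)=I$, $T(s+t)=T(t)T(s)$ for all $s,t\ge 0$, and $\lim_{t\to0^+}T(t)x=x$ for every $x\in H$. Its infinitesimal generator is the operator $Ax=\lim_{t\to0^+}\frac{T(t)x-x}{t}$ with domain $D(A)$ the set of $x\in H$ for which this limit exists. If $1\in\rho(A)$ (the resolvent set of $A$), the cogenerator of the semigroup is the bounded operator $V=(A+I)(A-I)^{-1}=I+2(A-I)^{-1}$; "the cogenerator exists" means $1\in\rho(A)$. A bounded operator $T$ on $H$ is an $m$-isometry if $\sum_{k=0}^m\binom{m}{k}(-1)^{m-k}\|T^kx\|^2=0$ for all $x\in H$. The zero polynomial is regarded as having degree less than $m$. *)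

theory Defs
  imports "HOL-Analysis.Analysis" "HOL-Computational_Algebra.Polynomial"
begin

section \<open>Complex Hilbert spaces\<close>

text \<open>
  The inner product is linear in the first and conjugate-linear in the second argument.
\<close>

class complex_inner_space = real_normed_vector +
  fixes scaleC :: "complex \<Rightarrow> 'a \<Rightarrow> 'a" (infixr \<open>*\<^sub>C\<close> 75)
    and cinner :: "'a \<Rightarrow> 'a \<Rightarrow> complex"
  assumes scaleC_add_right: "c *\<^sub>C (x + y) = c *\<^sub>C x + c *\<^sub>C y"
    and scaleC_add_left: "(c + d) *\<^sub>C x = c *\<^sub>C x + d *\<^sub>C x"
    and scaleC_scaleC: "c *\<^sub>C d *\<^sub>C x = (c * d) *\<^sub>C x"
    and scaleC_of_real: "complex_of_real r *\<^sub>C x = r *\<^sub>R x"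
    and cinner_commute: "cinner x y = cnj (cinner y x)"
    and cinner_add_left: "cinner (x + y) z = cinner x z + cinner y z"
    and cinner_scaleC_left: "cinner (c *\<^sub>C x) y = c * cinner x y"
    and cinner_self_nonneg: "0 \<le> Re (cinner x x)"
    and cinner_self_eq_0_iff: "cinner x x = 0 \<longleftrightarrow> x = 0"
    and norm_eq_sqrt_cinner: "norm x = sqrt (Re (cinner x x))"

class complex_hilbert_space = complex_inner_space + complete_space

instantiation complex :: complex_hilbert_space
begin

definition scaleC_complex :: "complex \<Rightarrow> complex \<Rightarrow> complex"
  where "scaleC_complex c x = c * x"

definition cinner_complex :: "complex \<Rightarrow> complex \<Rightarrow> complex"
  where "cinner_complex x y = x * cnj y"

instance
proof
  fix c d x y z :: complex and r :: real
  show "c *\<^sub>C (x + y) = c *\<^sub>C x + c *\<^sub>C y" "(c + d) *\<^sub>C x = c *\<^sub>C x + d *\<^sub>C x"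
    "c *\<^sub>C d *\<^sub>C x = (c * d) *\<^sub>C x" "complex_of_real r *\<^sub>C x = r *\<^sub>R x"
    by (simp_all add: scaleC_complex_def algebra_simps scaleR_conv_of_real)
  show "cinner x y = cnj (cinner y x)" "cinner (x + y) z = cinner x z + cinner y z"
    "cinner (c *\<^sub>C x) y = c * cinner x y" "0 \<le> Re (cinner x x)"
    "cinner x x = 0 \<longleftrightarrow> x = 0"
    by (simp_all add: cinner_complex_def scaleC_complex_def algebra_simps)
  show "norm x = sqrt (Re (cinner x x))"
    by (simp add: cinner_complex_def cmod_def power2_eq_square)
qed

end

definition bounded_clinear :: "('a::complex_inner_space \<Rightarrow> 'a) \<Rightarrow> bool"
  where "bounded_clinear f \<longleftrightarrow> bounded_linear f \<and> (\<forall>c x. f (c *\<^sub>C x) = c *\<^sub>C f x)"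

section \<open>Unbounded operators\<close>

text \<open>
  An unbounded operator is given by its domain \<open>D\<close> and a total function \<open>A\<close>
  whose values outside \<open>D\<close> are irrelevant.
\<close>

primrec power_domain :: "'a set \<Rightarrow> ('a \<Rightarrow> 'a) \<Rightarrow> nat \<Rightarrow> 'a set" where
  "power_domain D A 0 = UNIV"
| "power_domain D A (Suc n) = {x \<in> D. A x \<in> power_domain D A n}"

definition resolvent ::
    "'a::complex_inner_space set \<Rightarrow> ('a \<Rightarrow> 'a) \<Rightarrow> complex \<Rightarrow> 'a \<Rightarrow> 'a"
  where "resolvent D A \<mu> = the_inv_into D (\<lambda>x. A x - \<mu> *\<^sub>C x)"

definition resolvent_set :: "'a::complex_inner_space set \<Rightarrow> ('a \<Rightarrow> 'a) \<Rightarrow> complex set"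
  where "resolvent_set D A =
    {\<mu>. bij_betw (\<lambda>x. A x - \<mu> *\<^sub>C x) D UNIV \<and> bounded_clinear (resolvent D A \<mu>)}"

section \<open>Semigroups, generators and cogenerators\<close>

text \<open>Only the values \<open>T t\<close> for \<open>t \<ge> 0\<close> matter, here and below.\<close>

definition C0_semigroup :: "(real \<Rightarrow> 'a::complex_inner_space \<Rightarrow> 'a) \<Rightarrow> bool"
  where "C0_semigroup T \<longleftrightarrow>
    (\<forall>t\<ge>0. bounded_clinear (T t)) \<and>
    T 0 = id \<and>
    (\<forall>s\<ge>0. \<forall>t\<ge>0. T (s + t) = T t \<circ> T s) \<and>
    (\<forall>x. ((\<lambda>t. T t x) \<longlongrightarrow> x) (at_right 0))"

definition gen_domain :: "(real \<Rightarrow> 'a::complex_inner_space \<Rightarrow> 'a) \<Rightarrow> 'a set"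
  where "gen_domain T = {x. \<exists>y. ((\<lambda>t. (T t x - x) /\<^sub>R t) \<longlongrightarrow> y) (at_right 0)}"

definition generator :: "(real \<Rightarrow> 'a::complex_inner_space \<Rightarrow> 'a) \<Rightarrow> 'a \<Rightarrow> 'a"
  where "generator T x = Lim (at_right 0) (\<lambda>t. (T t x - x) /\<^sub>R t)"

definition cogenerator_exists :: "(real \<Rightarrow> 'a::complex_inner_space \<Rightarrow> 'a) \<Rightarrow> bool"
  where "cogenerator_exists T \<longleftrightarrow> 1 \<in> resolvent_set (gen_domain T) (generator T)"

definition cogenerator :: "(real \<Rightarrow> 'a::complex_inner_space \<Rightarrow> 'a) \<Rightarrow> 'a \<Rightarrow> 'a"
  where "cogenerator T y =
    (let x = resolvent (gen_domain T) (generator T) 1 y in generator T x + x)"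

lemma scaleC_one: "1 *\<^sub>C x = (x::'a::complex_inner_space)"
  using scaleC_of_real[of 1 x] by simp

lemma cogenerator_eq:
  assumes "cogenerator_exists T"
  shows "cogenerator T y = y + 2 *\<^sub>R resolvent (gen_domain T) (generator T) 1 y"
proof -
  have bij: "bij_betw (\<lambda>x. generator T x - 1 *\<^sub>C x) (gen_domain T) UNIV"
    using assms by (simp add: cogenerator_exists_def resolvent_set_def)
  define x where "x = resolvent (gen_domain T) (generator T) 1 y"
  have "generator T x - 1 *\<^sub>C x = y"
    unfolding x_def resolvent_def
    using f_the_inv_into_f_bij_betw[OF bij, of y] by simp
  then have "generator T x = y + x"
    by (simp add: scaleC_one algebra_simps)
  then show ?thesis
    by (simp add: cogenerator_def x_def[symmetric] Let_def scaleR_2)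
qed

definition m_isometry :: "nat \<Rightarrow> ('a::complex_inner_space \<Rightarrow> 'a) \<Rightarrow> bool"
  where "m_isometry m T \<longleftrightarrow> bounded_clinear T \<and>
    (\<forall>x. (\<Sum>k\<le>m. of_nat (m choose k) * (-1) ^ (m - k) * (norm ((T ^^ k) x))\<^sup>2) = 0)"

end

theory Submission
  imports Defs
begin

text \<open>
  Put \<open>f t = norm (T t x) ^ 2\<close>. Condition (i) says that all \<open>m\<close>-th forward differences of \<open>f\<close> vanish,
  which for a continuous function means being a polynomial of degree less than \<open>m\<close>. For \<open>x\<close> in
  \<open>D(A^m)\<close> the \<open>m\<close>-th derivative of \<open>f\<close> is the form in (iii) evaluated at \<open>T t x\<close>, and \<open>D(A^m)\<close> is
  dense, so (iii) is equivalent to (i) and (ii). Under (ii) the uniform boundedness principle gives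
  \<open>norm (T n) \<le> M exp (n / 2)\<close>, hence 1 is in the resolvent set. Once the cogenerator \<open>V\<close> exists,
  substituting \<open>y = (A - 1)^m z\<close> turns the \<open>m\<close>-isometry defect of \<open>V\<close> at \<open>y\<close> into \<open>2^m\<close> times the form
  in (iii) at \<open>z\<close>, and \<open>(A - 1)^m\<close> maps \<open>D(A^m)\<close> onto the whole space.
\<close>

section \<open>Forward differences and polynomials\<close>

text \<open>Pascal's rule. The second argument of \<open>F\<close> carries \<open>m - k\<close>, so
  that forward differences, the form in (iii) and the isometry defect are all instances.\<close>

lemma sum_binomial_Suc:
  fixes F :: "nat \<Rightarrow> nat \<Rightarrow> 'b::comm_ring_1"
  shows "(\<Sum>k\<le>Suc m. of_nat (Suc m choose k) * F k (Suc m - k)) =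
    (\<Sum>k\<le>m. of_nat (m choose k) * F (Suc k) (m - k)) + (\<Sum>k\<le>m. of_nat (m choose k) * F k (Suc (m - k)))"
proof -
  have "(\<Sum>k\<le>m. of_nat (m choose k) * F k (Suc (m - k))) = (\<Sum>k\<le>m. of_nat (m choose k) * F k (Suc m - k))"
    by (intro sum.cong) (auto simp: Suc_diff_le)
  also have "\<dots> = (\<Sum>k\<le>Suc m. of_nat (m choose k) * F k (Suc m - k))"
    by (simp add: binomial_eq_0)
  also have "\<dots> = F 0 (Suc m) + (\<Sum>k\<le>m. of_nat (m choose Suc k) * F (Suc k) (m - k))"
    by (simp add: sum.atMost_Suc_shift del: sum.atMost_Suc)
  finally show ?thesis
    by (simp add: sum.atMost_Suc_shift algebra_simps sum.distrib del: sum.atMost_Suc)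
qed

text \<open>The codomain is a general group because the same differences are taken of real squared
  norms and of complex-valued forms.\<close>

primrec fdiff :: "real \<Rightarrow> nat \<Rightarrow> (real \<Rightarrow> 'b::ab_group_add) \<Rightarrow> real \<Rightarrow> 'b" where
  "fdiff h 0 f t = f t"
| "fdiff h (Suc n) f t = fdiff h n f (t + h) - fdiff h n f t"

lemma fdiff_eq_sum:
  fixes f :: "real \<Rightarrow> real"
  shows "fdiff h m f t = (\<Sum>k\<le>m. of_nat (m choose k) * (-1) ^ (m - k) * f (t + real k * h))"
proof (induction m arbitrary: t)
  case (Suc m)
  let ?F = "\<lambda>k j. (-1) ^ j * f (t + real k * h)"
  have "fdiff h (Suc m) f t = (\<Sum>k\<le>m. of_nat (m choose k) * ?F (Suc k) (m - k)) +
      (\<Sum>k\<le>m. of_nat (m choose k) * ?F k (Suc (m - k)))"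
    by (simp add: Suc sum_negf distrib_right distrib_left add_ac mult_ac)
  also have "\<dots> = (\<Sum>k\<le>Suc m. of_nat (Suc m choose k) * ?F k (Suc m - k))"
    by (rule sum_binomial_Suc[of m ?F, symmetric])
  finally show ?case by (simp only: mult.assoc)
qed simp

lemma fdiff_diff: "fdiff h m (\<lambda>t. f t - g t) t = fdiff h m f t - fdiff h m g t"
  by (induction m arbitrary: t) (auto simp: algebra_simps)

lemma fdiff_has_vector_derivative:
  fixes f :: "real \<Rightarrow> 'b::real_normed_vector"
  assumes f: "\<And>t. t \<ge> 0 \<Longrightarrow> (f has_vector_derivative f' t) (at t within {0..})" and h: "h \<ge> 0"
  shows "t \<ge> 0 \<Longrightarrow> (fdiff h n f has_vector_derivative fdiff h n f' t) (at t within {0..})"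
proof (induction n arbitrary: t)
  case 0
  have "fdiff h 0 f = f" by auto
  then show ?case using f[OF 0] by simp
next
  case (Suc n)
  have shift: "((\<lambda>t. t + h) has_vector_derivative 1) (at t within {0..})"
    by (auto intro!: derivative_eq_intros)
  \<comment> \<open>Translation by \<open>h \<ge> 0\<close> maps the half line into itself, so the
    one-sided derivative at \<open>t + h\<close> restricts to the image and the chain rule
    applies.\<close>
  have "(fdiff h n f has_vector_derivative fdiff h n f' (t + h)) (at (t + h) within (\<lambda>t. t + h) ` {0..})"
    using h Suc by (intro has_vector_derivative_within_subset[OF Suc.IH]) auto
  from vector_diff_chain_within[OF shift this]
  have "((\<lambda>t. fdiff h n f (t + h)) has_vector_derivative fdiff h n f' (t + h)) (at t within {0..})"
    by (simp add: o_def)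
  from has_vector_derivative_diff[OF this Suc.IH[OF Suc.prems]]
  show ?case by simp
qed

text \<open>\<open>g\<close> lists a function and its successive derivatives, the last of which is
  zero. By induction the \<open>m\<close>-th difference of \<open>g 1\<close> vanishes, so that of
  \<open>g 0\<close> has derivative zero and is constant on the half line; one more difference kills
  the constant.\<close>

lemma fdiff_eq_0_of_chain:
  fixes g :: "nat \<Rightarrow> real \<Rightarrow> 'b::real_normed_vector"
  assumes "\<And>j t. j < m \<Longrightarrow> t \<ge> 0 \<Longrightarrow> (g j has_vector_derivative g (Suc j) t) (at t within {0..})"
    and "\<And>t. t \<ge> 0 \<Longrightarrow> g m t = 0" and "h \<ge> 0" and "t \<ge> 0"
  shows "fdiff h m (g 0) t = 0"
  using assms
proof (induction m arbitrary: g t)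
  case (Suc m)
  have 0: "fdiff h m (g (Suc 0)) t = 0" if "t \<ge> 0" for t
    using Suc.IH[of "\<lambda>j. g (Suc j)" t] Suc.prems that by auto
  have "(fdiff h m (g 0) has_vector_derivative 0) (at t within {0..})" if "t \<in> {0..}" for t
    using fdiff_has_vector_derivative[of "g 0" "g (Suc 0)" h t m] Suc.prems 0[of t] that by auto
  then obtain c where "\<And>t. t \<in> {0..} \<Longrightarrow> fdiff h m (g 0) t = c"
    using has_vector_derivative_zero_constant[of "{0..}" "fdiff h m (g 0)"] by auto
  with Suc.prems show ?case by simp
qed simp

lemma degree_funpow_pderiv: "degree ((pderiv ^^ n) p) = degree (p :: 'b::field_char_0 poly) - n"
  by (induction n) (auto simp: degree_pderiv)

lemma funpow_pderiv_eq_0: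
  fixes p :: "'b::field_char_0 poly"
  assumes "degree p < n"
  shows "(pderiv ^^ n) p = 0"
proof -
  obtain k where n: "n = Suc k" using assms by (cases n) auto
  have "degree ((pderiv ^^ k) p) = 0"
    using assms n by (simp add: degree_funpow_pderiv)
  then show ?thesis
    by (simp add: n pderiv_eq_0_iff)
qed

lemma fdiff_poly_eq_0:
  fixes p :: "real poly"
  assumes "degree p < m" "h \<ge> 0" "t \<ge> 0"
  shows "fdiff h m (poly p) t = 0"
proof -
  have "(poly ((pderiv ^^ j) p) has_vector_derivative poly ((pderiv ^^ Suc j) p) t) (at t within {0..})" for j t
    using poly_DERIV[of "(pderiv ^^ j) p" t]
    by (simp add: has_real_derivative_iff_has_vector_derivative has_vector_derivative_at_within)
  from fdiff_eq_0_of_chain[of m "\<lambda>j. poly ((pderiv ^^ j) p)" h t, OF this] assms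
  show ?thesis by (simp add: funpow_pderiv_eq_0)
qed

section \<open>Polynomial interpolation on equidistant grids\<close>

lemma poly_interpolation_exists:
  fixes h :: real
  assumes "h \<noteq> 0"
  shows "\<exists>p :: real poly. degree p \<le> n \<and> (\<forall>k\<le>n. poly p (real k * h) = a k)"
proof (induction n)
  case 0
  then show ?case by (intro exI[of _ "[:a 0:]"]) auto
next
  case (Suc n)
  then obtain p :: "real poly" where p: "degree p \<le> n" "\<forall>k\<le>n. poly p (real k * h) = a k" by auto
  \<comment> \<open>Newton's step: \<open>q\<close> vanishes at all earlier nodes but not at the new
    one, so adding a multiple of it corrects the new value only.\<close>
  define q where "q = (\<Prod>k\<le>n. [:- (real k * h), 1:])"
  have q0: "poly q (real k * h) = 0" if "k \<le> n" for k
    using that by (auto simp: q_def poly_prod)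
  have q1: "poly q (real (Suc n) * h) \<noteq> 0"
  proof -
    have "real (Suc n) * h - real k * h \<noteq> 0" if "k \<le> n" for k
      using assms that by (simp add: left_diff_distrib[symmetric] del: of_nat_Suc)
    then show ?thesis by (auto simp: q_def poly_prod simp del: of_nat_Suc)
  qed
  have "degree q \<le> Suc n"
    using degree_prod_sum_le[of "{..n}" "\<lambda>k. [:- (real k * h), 1:]"] by (simp add: q_def)
  define r where "r = p + smult ((a (Suc n) - poly p (real (Suc n) * h)) / poly q (real (Suc n) * h)) q"
  have "degree r \<le> Suc n"
    unfolding r_def using p \<open>degree q \<le> Suc n\<close>
    by (intro degree_add_le order.trans[OF degree_smult_le]) auto
  moreover have "poly r (real k * h) = a k" if "k \<le> Suc n" for k
    using that p q0 q1 by (cases "k = Suc n") (auto simp: r_def simp del: of_nat_Suc)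
  ultimately show ?case by blast
qed

text \<open>A vanishing \<open>m\<close>-th difference is a linear recurrence with leading
  coefficient 1, so each grid value is determined by the \<open>m\<close> values before it.\<close>

lemma zero_fdiff_grid_eq_0:
  fixes d :: "real \<Rightarrow> real"
  assumes d: "\<And>k. fdiff h m d (real k * h) = 0" and init: "\<And>k. k < m \<Longrightarrow> d (real k * h) = 0"
  shows "d (real k * h) = 0"
proof (induction k rule: less_induct)
  case (less k)
  show ?case
  proof (cases "k < m")
    case False
    have arg: "real (k - m) * h + real i * h = real (k - m + i) * h" for i
      by (simp add: algebra_simps)
    have "0 = (\<Sum>i\<le>m. of_nat (m choose i) * (-1) ^ (m - i) * d (real (k - m + i) * h))"
      using d[of "k - m"] unfolding fdiff_eq_sum arg by (rule sym)
    also have "\<dots> = (\<Sum>i\<le>m. if i = m then d (real k * h) else 0)"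
    proof (intro sum.cong refl)
      fix i assume "i \<in> {..m}"
      then consider "i = m" | "k - m + i < k" using False by force
      then show "of_nat (m choose i) * (-1) ^ (m - i) * d (real (k - m + i) * h) =
          (if i = m then d (real k * h) else 0)"
      proof cases
        case 1
        then have "k - m + i = k" using False by simp
        with 1 show ?thesis by (metis binomial_n_n diff_self_eq_0 mult_1 of_nat_1 power_0)
      next
        case 2
        then have "i \<noteq> m" using False by auto
        with less.IH[OF 2] show ?thesis by simp
      qed
    qed
    finally show ?thesis by simp
  qed (use init in auto)
qed

text \<open>Interpolate \<open>f\<close> at the first \<open>m\<close> nodes; the error obeys the
  same recurrence with zero initial values.\<close>

lemma zero_fdiff_grid_poly:
  fixes f :: "real \<Rightarrow> real"
  assumes "h > 0" and f: "\<And>t. t \<ge> 0 \<Longrightarrow> fdiff h m f t = 0" and "m > 0"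
  shows "\<exists>p :: real poly. degree p < m \<and> (\<forall>k. f (real k * h) = poly p (real k * h))"
proof -
  obtain p :: "real poly" where p: "degree p \<le> m - 1" "\<forall>k\<le>m - 1. poly p (real k * h) = f (real k * h)"
    using poly_interpolation_exists[of h "m - 1" "\<lambda>k. f (real k * h)"] \<open>h > 0\<close> by auto
  have "f (real k * h) - poly p (real k * h) = 0" for k
  proof (rule zero_fdiff_grid_eq_0[where d = "\<lambda>t. f t - poly p t" and m = m])
    show "fdiff h m (\<lambda>t. f t - poly p t) (real k * h) = 0" for k
      using \<open>h > 0\<close> \<open>m > 0\<close> p f[of "real k * h"]
      by (simp add: fdiff_diff fdiff_poly_eq_0)
  qed (use p in auto)
  with p \<open>m > 0\<close> show ?thesis by (intro exI[of _ p]) auto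
qed

lemma poly_eqI_of_nat:
  fixes p q :: "'b::{idom,ring_char_0} poly"
  assumes "\<And>n. poly p (of_nat n) = poly q (of_nat n)"
  shows "p = q"
proof (rule ccontr)
  assume "p \<noteq> q"
  then have "finite {x. poly (p - q) x = 0}" by (intro poly_roots_finite) auto
  moreover have "range of_nat \<subseteq> {x. poly (p - q) x = 0}" using assms by auto
  ultimately have "finite (range (of_nat :: nat \<Rightarrow> 'b))" by (rule finite_subset[rotated])
  then show False by (auto dest!: finite_imageD simp: inj_of_nat)
qed

text \<open>The interpolants on the grids of mesh \<open>1 / n\<close> all agree at the integers, so they coincide;
  right-continuity then reaches the irrational points.\<close>

lemma zero_fdiff_imp_poly:
  fixes f :: "real \<Rightarrow> real"
  assumes f: "\<And>h t. h \<ge> 0 \<Longrightarrow> t \<ge> 0 \<Longrightarrow> fdiff h m f t = 0" and "m > 0"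
    and cont: "\<And>t. t \<ge> 0 \<Longrightarrow> continuous (at_right t) f"
  shows "\<exists>p :: real poly. degree p < m \<and> (\<forall>t\<ge>0. f t = poly p t)"
proof -
  have "\<exists>p :: real poly. degree p < m \<and> (\<forall>k. f (real k * (1 / real (Suc n))) = poly p (real k * (1 / real (Suc n))))" for n
    using assms by (intro zero_fdiff_grid_poly) auto
  then obtain P :: "nat \<Rightarrow> real poly" where P: "\<And>n. degree (P n) < m"
      "\<And>n k. f (real k * (1 / real (Suc n))) = poly (P n) (real k * (1 / real (Suc n)))"
    by metis
  have "poly (P n) (of_nat k) = f (of_nat k)" for n k
  proof -
    have "real (k * Suc n) * (1 / real (Suc n)) = real k"
      unfolding of_nat_mult by (simp del: of_nat_Suc)
    with P(2)[of "k * Suc n" n] show ?thesis by metis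
  qed
  then have P0: "P n = P 0" for n by (intro poly_eqI_of_nat) simp
  have "f t = poly (P 0) t" if t: "t \<ge> 0" for t
  proof -
    \<comment> \<open>\<open>s n\<close> is the first point of the grid strictly to the right of
      \<open>t\<close>. Strictness makes \<open>s\<close> converge to \<open>t\<close> along
      \<open>at_right t\<close>, where \<open>f\<close> is known to be continuous.\<close>
    define k where "k n = Suc (nat \<lfloor>t * real (Suc n)\<rfloor>)" for n
    define s where "s n = real (k n) * (1 / real (Suc n))" for n
    have kr: "real (k n) = of_int \<lfloor>t * real (Suc n)\<rfloor> + 1" for n
      using t by (simp add: k_def)
    have s1: "t < s n" "s n \<le> t + 1 / real (Suc n)" for n
    proof -
      have "t * real (Suc n) < real (k n)" "real (k n) \<le> t * real (Suc n) + 1"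
        unfolding kr by linarith+
      then show "t < s n" "s n \<le> t + 1 / real (Suc n)"
        by (auto simp: s_def field_simps simp del: of_nat_Suc)
    qed
    have "(\<lambda>n. t + 1 / real (Suc n)) \<longlonglongrightarrow> t + 0"
      by (intro tendsto_intros LIMSEQ_Suc[OF lim_1_over_n])
    then have s2: "s \<longlonglongrightarrow> t"
      using s1 by (intro tendsto_sandwich[of "\<lambda>_. t" s sequentially]) (auto intro!: always_eventually less_imp_le)
    then have s3: "filterlim s (at_right t) sequentially"
      unfolding filterlim_at using s1(1) by (auto intro!: always_eventually simp: less_imp_neq[symmetric])
    have "(\<lambda>n. f (s n)) \<longlonglongrightarrow> f t"
      using filterlim_compose[OF cont[OF t, unfolded continuous_within] s3] .
    moreover have "f (s n) = poly (P 0) (s n)" for n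
      using P(2)[of "k n" n] P0 unfolding s_def by metis
    moreover have "(\<lambda>n. poly (P 0) (s n)) \<longlonglongrightarrow> poly (P 0) t"
      by (intro tendsto_poly s2)
    ultimately show ?thesis using LIMSEQ_unique by simp
  qed
  with P show ?thesis by blast
qed

lemma poly_over_exp_tendsto_0: "((\<lambda>x :: real. poly p x / exp x) \<longlongrightarrow> 0) at_top"
proof -
  have "((\<lambda>x :: real. \<Sum>i\<le>degree p. coeff p i * (x ^ i / exp x)) \<longlongrightarrow> (\<Sum>i\<le>degree p. coeff p i * 0)) at_top"
    by (intro tendsto_intros tendsto_power_div_exp_0)
  then show ?thesis by (simp add: poly_altdef sum_divide_distrib)
qed

section \<open>Uniform boundedness\<close>

text \<open>The closed sets \<open>C n\<close> cover the complete space, so by Baire one of them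
  contains a ball; linearity carries the bound from this ball to all vectors.\<close>

lemma uniform_boundedness:
  fixes F :: "'i \<Rightarrow> 'a::{real_normed_vector,complete_space} \<Rightarrow> 'b::real_normed_vector"
  assumes lin: "\<And>i. bounded_linear (F i)" and bdd: "\<And>x. \<exists>B. \<forall>i. norm (F i x) \<le> B"
  obtains M where "M > 0" "\<And>i x. norm (F i x) \<le> M * norm x"
proof -
  define C where "C n = {x. \<forall>i. norm (F i x) \<le> real n}" for n :: nat
  have closed: "closed (C n)" for n
    unfolding C_def Collect_all_eq
    by (intro closed_INT closed_Collect_le continuous_intros ballI
        linear_continuous_on[OF lin])
  have "x \<in> (\<Union>n. C n)" for x
  proof -
    obtain B where "\<forall>i. norm (F i x) \<le> B" using bdd by blast
    moreover obtain n where "B \<le> real n" using real_arch_simple by blast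
    ultimately show ?thesis by (auto simp: C_def intro: order.trans)
  qed
  then have "\<Union>(range C) = UNIV" by auto
  moreover have "interior (\<Union>(range C)) = {}" if "\<And>n. interior (C n) = {}"
    using Baire_category_alt[OF disjI1[OF completely_metrizable_space_euclidean], of "range C"] closed that
    by auto
  ultimately obtain n x where "x \<in> interior (C n)"
    by (metis UNIV_not_empty ex_in_conv interior_UNIV)
  then obtain r where r: "r > 0" "ball x r \<subseteq> C n" by (meson mem_interior)
  \<comment> \<open>The summand 1 keeps the constant positive when \<open>n = 0\<close>.\<close>
  have *: "norm (F i z) \<le> (4 * (real n + 1) / r) * norm z" for i z
  proof (cases "z = 0")
    case False
    \<comment> \<open>Scaled by \<open>c\<close>, the vector \<open>z\<close> has norm
      \<open>r / 2\<close>, so \<open>x + c *\<^sub>R z\<close> stays in the ball.\<close>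
    define c where "c = r / (2 * norm z)"
    have c: "c > 0" using r False by (simp add: c_def)
    have "x + c *\<^sub>R z \<in> C n" "x \<in> C n"
      using r False by (auto intro!: subsetD[OF r(2)] simp: dist_norm c_def)
    then have "norm (F i (x + c *\<^sub>R z)) \<le> real n" "norm (F i x) \<le> real n" by (auto simp: C_def)
    moreover have "F i (c *\<^sub>R z) = F i (x + c *\<^sub>R z) - F i x"
      using lin[of i] by (simp add: bounded_linear.linear linear_add)
    ultimately have "norm (F i (c *\<^sub>R z)) \<le> real n + real n"
      by (metis norm_triangle_le_diff add_mono)
    moreover have "F i (c *\<^sub>R z) = c *\<^sub>R F i z"
      using lin[of i] by (simp add: bounded_linear.linear linear_scale)
    ultimately have "c * norm (F i z) \<le> 2 * (real n + 1)" using c by simp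
    then have "norm (F i z) \<le> 2 * (real n + 1) / c" using c by (simp add: field_simps)
    then show ?thesis by (simp add: c_def field_simps)
  qed (use lin[of i] in \<open>simp add: bounded_linear.linear linear_0\<close>)
  show thesis by (rule that[OF _ *]) (use r in auto)
qed

section \<open>Complex inner product spaces\<close>

instance complex_hilbert_space \<subseteq> banach ..

lemma cinner_add_right: "cinner x (y + z) = cinner x y + cinner x (z :: 'a::complex_inner_space)"
  by (subst (1 2 3) cinner_commute) (simp add: cinner_add_left)

lemma cinner_scaleC_right: "cinner x (c *\<^sub>C y) = cnj c * cinner x (y :: 'a::complex_inner_space)"
  by (subst (1 2) cinner_commute) (simp add: cinner_scaleC_left)

lemma cinner_scaleR_left: "cinner (r *\<^sub>R x) y = r *\<^sub>R cinner x (y :: 'a::complex_inner_space)"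
  by (metis cinner_scaleC_left scaleC_of_real scaleR_conv_of_real)

lemma cinner_scaleR_right: "cinner x (r *\<^sub>R y) = r *\<^sub>R cinner x (y :: 'a::complex_inner_space)"
  by (metis cinner_scaleC_right scaleC_of_real scaleR_conv_of_real complex_cnj_complex_of_real)

lemma cinner_self: "cinner x x = of_real ((norm (x :: 'a::complex_inner_space))\<^sup>2)"
proof -
  have "Im (cinner x x) = 0" using cinner_commute[of x x] by (simp add: complex_eq_iff)
  then show ?thesis by (simp add: complex_eq_iff norm_eq_sqrt_cinner cinner_self_nonneg)
qed

lemma norm_scaleC: "norm (c *\<^sub>C x) = cmod c * norm (x :: 'a::complex_inner_space)"
proof -
  have "complex_of_real ((norm (c *\<^sub>C x))\<^sup>2) = c * cnj c * cinner x x"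
    unfolding cinner_self[symmetric] by (simp add: cinner_scaleC_left cinner_scaleC_right)
  also have "\<dots> = of_real ((cmod c * norm x)\<^sup>2)"
    by (simp add: cinner_self power_mult_distrib complex_norm_square[symmetric])
  finally have "complex_of_real ((norm (c *\<^sub>C x))\<^sup>2) = of_real ((cmod c * norm x)\<^sup>2)" .
  then show ?thesis by (simp del: of_real_power)
qed

lemma bounded_linear_scaleC: "bounded_linear (\<lambda>x :: 'a::complex_inner_space. c *\<^sub>C x)"
proof (rule bounded_linear_intro[of _ "cmod c"])
  fix x y :: 'a and r
  show "c *\<^sub>C (r *\<^sub>R x) = r *\<^sub>R (c *\<^sub>C x)"
    by (metis scaleC_of_real scaleC_scaleC mult.commute)
qed (auto simp: scaleC_add_right norm_scaleC)

text \<open>Cauchy-Schwarz for the real part. With \<open>a = norm x\<close> and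
  \<open>b = norm y\<close>, the squared norm of \<open>b *\<^sub>R x - a *\<^sub>R y\<close> equals
  \<open>2 * (a * b) * (a * b - Re (cinner x y))\<close>.\<close>

lemma Re_cinner_le: "Re (cinner x y) \<le> norm x * norm (y :: 'a::complex_inner_space)"
proof (cases "x = 0 \<or> y = 0")
  case True
  then show ?thesis
    using cinner_scaleR_left[of 0 0 y] cinner_scaleR_right[of x 0 0] by auto
next
  case False
  define a b where "a = norm x" and "b = norm y"
  have ab: "a > 0" "b > 0" using False by (auto simp: a_def b_def)
  have cinner_minus: "cinner u (- v) = - cinner u v" "cinner (- u) v = - cinner u v" for u v :: 'a
    using cinner_scaleR_right[of u "-1" v] cinner_scaleR_left[of "-1" u v] by simp_all
  define z where "z = b *\<^sub>R x + - (a *\<^sub>R y)"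
  have "cinner z z = of_real (b * b) * cinner x x + of_real (a * a) * cinner y y
      - of_real (a * b) * (cinner x y + cinner y x)"
    unfolding z_def cinner_add_left cinner_add_right cinner_scaleR_left cinner_scaleR_right cinner_minus
    by (simp add: scaleR_conv_of_real algebra_simps)
  moreover have "cinner x y + cinner y x = of_real (2 * Re (cinner x y))"
    using cinner_commute[of x y] by (simp add: complex_eq_iff)
  ultimately have "cinner z z = of_real (2 * (a * b) * (a * b - Re (cinner x y)))"
    by (simp add: cinner_self a_def b_def algebra_simps power2_eq_square)
  then have "0 \<le> 2 * (a * b) * (a * b - Re (cinner x y))"
    using cinner_self_nonneg[of z] by simp
  moreover have "0 < 2 * (a * b)" using ab by simp
  ultimately have "0 \<le> a * b - Re (cinner x y)" by (simp only: zero_le_mult_iff) auto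
  then show ?thesis by (simp add: a_def b_def)
qed

text \<open>The imaginary part of \<open>cinner x y\<close> is the real part of
  \<open>cinner x (\<i> *\<^sub>C y)\<close>, so the bound on real parts is used twice, whence the
  factor 2. This makes the product rule available for inner products of orbits.\<close>

lemma bounded_bilinear_cinner: "bounded_bilinear (cinner :: 'a::complex_inner_space \<Rightarrow> 'a \<Rightarrow> complex)"
proof
  have abs_Re: "\<bar>Re (cinner x y)\<bar> \<le> norm x * norm y" for x y :: 'a
    using Re_cinner_le[of x y] Re_cinner_le[of "- 1 *\<^sub>R x" y] by (simp only: cinner_scaleR_left) auto
  have "norm (cinner x y) \<le> norm x * norm y * 2" for x y :: 'a
    using cmod_le[of "cinner x y"] abs_Re[of x y] abs_Re[of x "\<i> *\<^sub>C y"]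
    by (simp add: cinner_scaleC_right norm_scaleC)
  then show "\<exists>K. \<forall>x y :: 'a. norm (cinner x y) \<le> norm x * norm y * K" by blast
qed (auto simp: cinner_add_left cinner_add_right cinner_scaleR_left cinner_scaleR_right)

section \<open>Strongly continuous semigroups\<close>

text \<open>The generator as a relation: a single limit yields both membership in the domain and the
  value.\<close>

definition has_gen :: "(real \<Rightarrow> 'a::complex_inner_space \<Rightarrow> 'a) \<Rightarrow> 'a \<Rightarrow> 'a \<Rightarrow> bool"
  where "has_gen T x y \<longleftrightarrow> ((\<lambda>t. (T t x - x) /\<^sub>R t) \<longlongrightarrow> y) (at_right 0)"

lemma has_genD:
  assumes "has_gen T x y"
  shows "x \<in> gen_domain T" "generator T x = y"
  using assms by (auto simp: has_gen_def gen_domain_def generator_def intro!: tendsto_Lim)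

lemma has_gen_generator:
  assumes "x \<in> gen_domain T"
  shows "has_gen T x (generator T x)"
proof -
  obtain y where "has_gen T x y" using assms by (auto simp: has_gen_def gen_domain_def)
  with has_genD(2)[OF this] show ?thesis by simp
qed

text \<open>Bridge from derivatives on the half line to right difference quotients, the form in
  which the generator is defined.\<close>

lemma has_vector_derivative_tendsto_at_right_0:
  fixes f :: "real \<Rightarrow> 'b::real_normed_vector"
  assumes f: "(f has_vector_derivative f') (at t within {0..})" and "t \<ge> 0"
  shows "((\<lambda>h. (f (t + h) - f t) /\<^sub>R h) \<longlongrightarrow> f') (at_right 0)"
proof -
  have "((\<lambda>h. t + h) has_vector_derivative 1) (at 0 within {0..})"
    by (auto intro!: derivative_eq_intros)
  moreover have "(f has_vector_derivative f') (at (t + 0) within (\<lambda>h. t + h) ` {0..})"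
    using assms by (intro has_vector_derivative_within_subset[OF _ image_subsetI]) auto
  ultimately have "((\<lambda>h. f (t + h)) has_vector_derivative f') (at 0 within {0..})"
    using vector_diff_chain_within[of "\<lambda>h. t + h" 1 0 "{0..}" f f'] by (simp add: o_def)
  then have "((\<lambda>h. (f (t + h) - f t - h *\<^sub>R f') /\<^sub>R norm h) \<longlongrightarrow> 0) (at_right 0)"
    by (simp add: has_vector_derivative_def has_derivative_at_within at_within_Ici_at_right)
  moreover have "\<forall>\<^sub>F h in at_right 0. (f (t + h) - f t - h *\<^sub>R f') /\<^sub>R norm h = (f (t + h) - f t) /\<^sub>R h - f'"
    using eventually_at_right_less[of "0::real"]
  proof eventually_elim
    case (elim h)
    then have "norm h = h" "inverse h * h = 1" by auto
    then show ?case by (simp only: scaleR_diff_right scaleR_scaleR scaleR_one)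
  qed
  ultimately have "((\<lambda>h. (f (t + h) - f t) /\<^sub>R h - f') \<longlongrightarrow> 0) (at_right 0)"
    by (rule Lim_transform_eventually)
  then show ?thesis by (simp add: LIM_zero_iff)
qed

text \<open>The product rule at 0 from the right. With \<open>c = -1\<close> and
  \<open>c = 1\<close> it translates between \<open>A\<close> and \<open>A - 1\<close>.\<close>

lemma has_gen_rescale:
  assumes "has_gen T x y"
  shows "has_gen (\<lambda>t x. exp (c * t) *\<^sub>R T t x) x (y + c *\<^sub>R x)"
proof -
  have "((\<lambda>t. exp (c * t)) has_vector_derivative c) (at 0 within {0..})"
    unfolding has_real_derivative_iff_has_vector_derivative[symmetric]
    by (auto intro!: derivative_eq_intros)
  from has_vector_derivative_tendsto_at_right_0[OF this]
  have 1: "((\<lambda>t. (exp (c * t) - 1) /\<^sub>R t) \<longlongrightarrow> c) (at_right 0)" by simp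
  have 2: "((\<lambda>t. exp (c * t)) \<longlongrightarrow> exp (c * 0)) (at_right 0)"
    by (intro tendsto_intros)
  have "((\<lambda>t. exp (c * t) *\<^sub>R ((T t x - x) /\<^sub>R t) + ((exp (c * t) - 1) /\<^sub>R t) *\<^sub>R x) \<longlongrightarrow>
      exp (c * 0) *\<^sub>R y + c *\<^sub>R x) (at_right 0)"
    using assms by (intro tendsto_intros 1 2) (simp add: has_gen_def)
  moreover have "exp (c * t) *\<^sub>R ((T t x - x) /\<^sub>R t) + ((exp (c * t) - 1) /\<^sub>R t) *\<^sub>R x =
      (exp (c * t) *\<^sub>R T t x - x) /\<^sub>R t" for t
    by (simp add: algebra_simps)
  ultimately show ?thesis by (simp add: has_gen_def)
qed

locale c0_semigroup =
  fixes T :: "real \<Rightarrow> 'a::complex_hilbert_space \<Rightarrow> 'a"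
  assumes C0: "C0_semigroup T"
begin

abbreviation "D \<equiv> gen_domain T"
abbreviation "A \<equiv> generator T"
abbreviation "Dn \<equiv> power_domain D A"

lemma bounded_linear_T: "t \<ge> 0 \<Longrightarrow> bounded_linear (T t)"
  using C0 by (auto simp: C0_semigroup_def bounded_clinear_def)

lemma T_scaleC: "t \<ge> 0 \<Longrightarrow> T t (c *\<^sub>C x) = c *\<^sub>C T t x"
  using C0 by (auto simp: C0_semigroup_def bounded_clinear_def)

lemma T_add: "t \<ge> 0 \<Longrightarrow> T t (x + y) = T t x + T t y"
  using bounded_linear_T by (simp add: bounded_linear.linear linear_add)

lemma T_diff: "t \<ge> 0 \<Longrightarrow> T t (x - y) = T t x - T t y"
  using bounded_linear_T by (simp add: bounded_linear.linear linear_diff)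

lemma T_scaleR: "t \<ge> 0 \<Longrightarrow> T t (r *\<^sub>R x) = r *\<^sub>R T t x"
  using bounded_linear_T by (simp add: bounded_linear.linear linear_scale)

lemma T_0 [simp]: "T 0 x = x"
  using C0 by (simp add: C0_semigroup_def)

lemma T_plus: "s \<ge> 0 \<Longrightarrow> t \<ge> 0 \<Longrightarrow> T (s + t) x = T t (T s x)"
  using C0 by (simp add: C0_semigroup_def)

lemma T_commute: "s \<ge> 0 \<Longrightarrow> t \<ge> 0 \<Longrightarrow> T t (T s x) = T s (T t x)"
  by (metis T_plus add.commute)

lemma T_funpow: "t \<ge> 0 \<Longrightarrow> (T t ^^ k) x = T (real k * t) x"
proof (induction k)
  case (Suc k)
  then have "T (real (Suc k) * t) x = T t (T (real k * t) x)"
    using T_plus[of "real k * t" t x] by (simp add: algebra_simps)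
  with Suc show ?case by simp
qed simp

section \<open>Local boundedness and strong continuity\<close>

lemma T_tendsto_0: "((\<lambda>t. T t x) \<longlongrightarrow> x) (at_right 0)"
  using C0 by (simp add: C0_semigroup_def)

text \<open>Otherwise there are times \<open>t n\<close> tending to 0 at which
  \<open>T (t n)\<close> violates the bound with constant \<open>n + 1\<close>. But each
  \<open>T (t n) y\<close> converges to \<open>y\<close> and so is bounded, against the uniform
  boundedness principle.\<close>

lemma locally_bounded_0: "\<exists>M\<ge>1. \<exists>\<delta>>0. \<forall>t\<in>{0..\<delta>}. \<forall>x. norm (T t x) \<le> M * norm x"
proof (rule ccontr)
  assume *: "\<not> ?thesis"
  have "\<exists>t x. t \<in> {0..1 / real (Suc n)} \<and> norm (T t x) > real (Suc n) * norm x" for n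
  proof (rule ccontr)
    assume "\<not> ?thesis"
    then have "1 \<le> real (Suc n) \<and> (\<exists>\<delta>>0. \<forall>t\<in>{0..\<delta>}. \<forall>x. norm (T t x) \<le> real (Suc n) * norm x)"
      by (intro conjI exI[of _ "1 / real (Suc n)"]) (auto simp: not_less)
    with * show False by blast
  qed
  then obtain t x where t: "\<And>n. t n \<in> {0..1 / real (Suc n)}"
      and x: "\<And>n. norm (T (t n) (x n)) > real (Suc n) * norm (x n)"
    by metis
  have "t \<longlonglongrightarrow> 0"
    by (rule tendsto_sandwich[OF _ _ tendsto_const LIMSEQ_Suc[OF lim_1_over_n]])
      (use t in \<open>auto intro!: always_eventually\<close>)
  have "\<exists>B. \<forall>n. norm (T (t n) y) \<le> B" for y
  proof -
    have "continuous (at 0 within {0..}) (\<lambda>t. T t y)"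
      using T_tendsto_0 by (simp add: continuous_within at_within_Ici_at_right)
    then have "((\<lambda>t. T t y) \<circ> t) \<longlonglongrightarrow> T 0 y"
      unfolding continuous_within_sequentially using t \<open>t \<longlonglongrightarrow> 0\<close> by auto
    then have "Bseq (\<lambda>n. T (t n) y)"
      by (intro convergent_imp_Bseq convergentI) (simp add: o_def)
    then show ?thesis by (auto simp: Bseq_def)
  qed
  then obtain M where M: "\<And>n y. norm (T (t n) y) \<le> M * norm y"
    using uniform_boundedness[of "\<lambda>n. T (t n)"] bounded_linear_T t by (metis atLeastAtMost_iff)
  obtain n where "M \<le> real (Suc n)" by (meson real_arch_simple le_SucI of_nat_le_iff order.trans le_add2)
  then have "M * norm (x n) \<le> real (Suc n) * norm (x n)" by (intro mult_right_mono) auto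
  with M[of n "x n"] x[of n] show False by linarith
qed

text \<open>An interval of length \<open>n * \<delta>\<close> is crossed in \<open>n\<close> steps
  of length at most \<open>\<delta>\<close>, each costing a factor \<open>M\<close>.\<close>

lemma bounded_on_interval: "\<exists>M\<ge>1. \<forall>t\<in>{0..\<tau>}. \<forall>x. norm (T t x) \<le> M * norm x"
proof -
  obtain M \<delta> where M: "M \<ge> 1" "\<delta> > 0" "\<And>t x. t \<in> {0..\<delta>} \<Longrightarrow> norm (T t x) \<le> M * norm x"
    using locally_bounded_0 by metis
  have "norm (T t x) \<le> M ^ n * norm x" if "t \<in> {0..real n * \<delta>}" for t x n
    using that
  proof (induction n arbitrary: t)
    case (Suc n)
    define s where "s = min \<delta> t"
    have s: "s \<in> {0..\<delta>}" "t - s \<in> {0..real n * \<delta>}"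
      using Suc.prems M by (auto simp: s_def min_def algebra_simps)
    have "norm (T t x) = norm (T s (T (t - s) x))"
      using s T_plus[of "t - s" s x] by simp
    also have "\<dots> \<le> M * norm (T (t - s) x)" by (intro M s)
    also have "\<dots> \<le> M * (M ^ n * norm x)"
      using M by (intro mult_left_mono Suc.IH s) auto
    finally show ?case by simp
  qed simp
  moreover obtain n where "\<tau> / \<delta> \<le> real n" using real_arch_simple by blast
  ultimately show ?thesis
    using M by (intro exI[of _ "M ^ n"]) (auto simp: field_simps)
qed

text \<open>For \<open>a \<le> b\<close> the increment is \<open>T a\<close> applied to
  \<open>T (b - a) x - x\<close>. The bound on \<open>T a\<close> is uniform on
  \<open>{0..t + 1}\<close>, so left and right continuity at \<open>t\<close> both follow from
  continuity at 0.\<close>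

lemma continuous_T: "continuous_on {0..} (\<lambda>t. T t x)"
proof -
  have "\<exists>d>0. \<forall>s\<in>{0..}. dist s t < d \<longrightarrow> dist (T s x) (T t x) < e" if "t \<ge> 0" "e > 0" for t e
  proof -
    obtain M where M: "M \<ge> 1" "\<And>s x. s \<in> {0..t + 1} \<Longrightarrow> norm (T s x) \<le> M * norm x"
      using bounded_on_interval[of "t + 1"] by metis
    have "\<forall>\<^sub>F s in at_right 0. dist (T s x) x < e / M"
      using T_tendsto_0 M that by (intro tendstoD) auto
    then obtain d where d: "d > 0" "\<And>s. 0 < s \<Longrightarrow> s < d \<Longrightarrow> dist (T s x) x < e / M"
      unfolding eventually_at_right_field by auto
    have main: "norm (T b x - T a x) < e" if "0 \<le> a" "a \<le> b" "b - a < d" "b \<le> t + 1" for a b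
    proof -
      have "norm (T (b - a) x - x) < e / M"
        using d(2)[of "b - a"] that M \<open>e > 0\<close> by (cases "a = b") (auto simp: dist_norm)
      have "T b x - T a x = T a (T (b - a) x - x)"
        using that T_plus[of "b - a" a x] by (simp add: T_diff)
      then have "norm (T b x - T a x) \<le> M * norm (T (b - a) x - x)"
        using M(2)[of a] that by simp
      also have "\<dots> < M * (e / M)"
        using M \<open>norm (T (b - a) x - x) < e / M\<close> by (intro mult_strict_left_mono) auto
      finally show ?thesis using M by simp
    qed
    have "dist (T s x) (T t x) < e" if "s \<ge> 0" "dist s t < min d 1" for s
    proof (cases "s \<le> t")
      case True
      with main[of s t] that \<open>t \<ge> 0\<close> show ?thesis
        by (simp add: dist_norm norm_minus_commute dist_real_def)
    next
      case False
      with main[of t s] that \<open>t \<ge> 0\<close> show ?thesis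
        by (simp add: dist_norm dist_real_def)
    qed
    with d show ?thesis by (intro exI[of _ "min d 1"]) auto
  qed
  then show ?thesis unfolding continuous_on_iff by auto
qed

lemma continuous_on_T_interval: "0 \<le> a \<Longrightarrow> continuous_on {a..b} (\<lambda>t. T t x)"
  by (rule continuous_on_subset[OF continuous_T]) auto

section \<open>Integrals of orbits\<close>

definition J :: "real \<Rightarrow> 'a \<Rightarrow> 'a" where "J \<tau> x = integral {0..\<tau>} (\<lambda>t. T t x)"

lemma J_0 [simp]: "J 0 x = 0"
  by (simp add: J_def)

lemma T_integrable: "(\<lambda>t. T t x) integrable_on {0..\<tau>}"
  by (intro integrable_continuous_interval continuous_on_T_interval) simp

lemma bounded_linear_J:
  assumes "\<tau> \<ge> 0"
  shows "bounded_linear (J \<tau>)"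
proof -
  obtain M where M: "M \<ge> 1" "\<And>t x. t \<in> {0..\<tau>} \<Longrightarrow> norm (T t x) \<le> M * norm x"
    using bounded_on_interval[of \<tau>] by metis
  show ?thesis
  proof (rule bounded_linear_intro[of _ "M * \<tau>"])
    fix x y r
    have "J \<tau> (x + y) = integral {0..\<tau>} (\<lambda>t. T t x + T t y)"
      unfolding J_def by (intro integral_cong) (simp add: T_add)
    then show "J \<tau> (x + y) = J \<tau> x + J \<tau> y"
      by (simp add: J_def integral_add T_integrable)
    have "J \<tau> (r *\<^sub>R x) = integral {0..\<tau>} (\<lambda>t. r *\<^sub>R T t x)"
      unfolding J_def by (intro integral_cong) (simp add: T_scaleR)
    then show "J \<tau> (r *\<^sub>R x) = r *\<^sub>R J \<tau> x"
      by (simp add: J_def)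
    have "norm (J \<tau> x) \<le> (M * norm x) * (\<tau> - 0)"
      unfolding J_def by (rule integral_bound) (use assms M in \<open>auto intro: continuous_on_T_interval\<close>)
    then show "norm (J \<tau> x) \<le> norm x * (M * \<tau>)" by (simp add: mult_ac)
  qed
qed

lemma J_has_vector_derivative:
  assumes "t \<ge> 0"
  shows "((\<lambda>t. J t x) has_vector_derivative T t x) (at t within {0..})"
proof -
  have "((\<lambda>t. J t x) has_vector_derivative T t x) (at t within {0..t + 1})"
    unfolding J_def using assms
    by (intro integral_has_vector_derivative continuous_on_T_interval) auto
  moreover have "at t within {0..t + 1} = at t within {0..}"
    by (rule at_within_nhd[of _ "{..<t + 1}"]) auto
  ultimately show ?thesis by simp
qed

lemma T_J: "\<tau> \<ge> 0 \<Longrightarrow> h \<ge> 0 \<Longrightarrow> T h (J \<tau> x) = J \<tau> (T h x)"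
proof -
  assume *: "\<tau> \<ge> 0" "h \<ge> 0"
  have "T h (J \<tau> x) = integral {0..\<tau>} (T h \<circ> (\<lambda>t. T t x))"
    unfolding J_def by (intro integral_linear[symmetric] T_integrable bounded_linear_T *)
  also have "\<dots> = J \<tau> (T h x)"
    unfolding J_def by (intro integral_cong) (simp add: T_commute *)
  finally show ?thesis .
qed

lemma J_T_shift:
  assumes "\<tau> \<ge> 0" "h \<ge> 0"
  shows "J \<tau> (T h x) = J (\<tau> + h) x - J h x"
proof -
  have "J \<tau> (T h x) = integral {h - h..\<tau> + h - h} (\<lambda>t. T (t + h) x)"
    using assms by (auto simp: J_def T_plus[symmetric] add.commute intro!: integral_cong)
  also have "\<dots> = integral {h..\<tau> + h} (\<lambda>t. T t x)" by (rule integral_shift_real_ivl)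
  also have "integral {0..h} (\<lambda>t. T t x) + \<dots> = J (\<tau> + h) x"
    unfolding J_def using assms by (intro Henstock_Kurzweil_Integration.integral_combine T_integrable) auto
  finally show ?thesis by (simp add: J_def algebra_simps)
qed

text \<open>By the shift rule, \<open>T h (J \<tau> x) - J \<tau> x\<close> is the increment of the
  integral over \<open>h\<close> at \<open>\<tau>\<close> minus that at 0, so the limit is a
  difference of two derivatives of \<open>J\<close>.\<close>

lemma has_gen_J:
  assumes "\<tau> \<ge> 0"
  shows "has_gen T (J \<tau> x) (T \<tau> x - x)"
proof -
  have "((\<lambda>h. (J (\<tau> + h) x - J \<tau> x) /\<^sub>R h - (J (0 + h) x - J 0 x) /\<^sub>R h) \<longlongrightarrow> T \<tau> x - T 0 x) (at_right 0)"
    using assms by (intro tendsto_diff has_vector_derivative_tendsto_at_right_0 J_has_vector_derivative) auto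
  moreover have "\<forall>\<^sub>F h in at_right 0. (J (\<tau> + h) x - J \<tau> x) /\<^sub>R h - (J (0 + h) x - J 0 x) /\<^sub>R h =
      (T h (J \<tau> x) - J \<tau> x) /\<^sub>R h"
    using eventually_at_right_less[of "0::real"]
    by eventually_elim (use assms in \<open>simp add: T_J J_T_shift algebra_simps\<close>)
  ultimately have "((\<lambda>h. (T h (J \<tau> x) - J \<tau> x) /\<^sub>R h) \<longlongrightarrow> T \<tau> x - T 0 x) (at_right 0)"
    by (rule Lim_transform_eventually)
  then show ?thesis by (simp add: has_gen_def)
qed

section \<open>Algebra of the generator and the orbit equation\<close>

lemma has_gen_bounded_linear:
  assumes "x \<in> D" "bounded_linear L" and comm: "\<And>t. t > 0 \<Longrightarrow> T t (L x) = L (T t x)"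
  shows "has_gen T (L x) (L (A x))"
proof -
  have "((\<lambda>t. L ((T t x - x) /\<^sub>R t)) \<longlongrightarrow> L (A x)) (at_right 0)"
    using has_gen_generator[OF assms(1)] bounded_linear.tendsto[OF assms(2)]
    by (auto simp: has_gen_def)
  moreover have "\<forall>\<^sub>F t in at_right 0. L ((T t x - x) /\<^sub>R t) = (T t (L x) - L x) /\<^sub>R t"
    using eventually_at_right_less[of "0::real"]
    by eventually_elim (use assms in \<open>simp add: comm bounded_linear.linear linear_diff linear_scale\<close>)
  ultimately show ?thesis
    unfolding has_gen_def by (rule Lim_transform_eventually)
qed

text \<open>\<open>A (J \<tau> x)\<close> computed in two ways: by the fundamental theorem, and by
  moving \<open>A\<close> through the integral.\<close>

lemma J_A: "x \<in> D \<Longrightarrow> \<tau> \<ge> 0 \<Longrightarrow> J \<tau> (A x) = T \<tau> x - x"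
  using has_genD(2)[OF has_gen_J] has_genD(2)[OF has_gen_bounded_linear[of x "J \<tau>"]]
  by (simp add: bounded_linear_J T_J)

lemma
  assumes "x \<in> D" "t \<ge> 0"
  shows T_in_D: "T t x \<in> D" and A_T: "A (T t x) = T t (A x)"
  using has_genD[OF has_gen_bounded_linear[of x "T t"]] assms
  by (simp_all add: bounded_linear_T T_commute)

lemma
  assumes "x \<in> D"
  shows scaleC_in_D: "c *\<^sub>C x \<in> D" and A_scaleC: "A (c *\<^sub>C x) = c *\<^sub>C A x"
  using has_genD[OF has_gen_bounded_linear[of x "\<lambda>x. c *\<^sub>C x"]] assms
  by (simp_all add: bounded_linear_scaleC T_scaleC)

lemma
  assumes "x \<in> D"
  shows scaleR_in_D: "r *\<^sub>R x \<in> D" and A_scaleR: "A (r *\<^sub>R x) = r *\<^sub>R A x"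
  using scaleC_in_D[OF assms] A_scaleC[OF assms] by (simp_all flip: scaleC_of_real)

lemma
  assumes "x \<in> D" "y \<in> D"
  shows add_in_D: "x + y \<in> D" and A_add: "A (x + y) = A x + A y"
proof -
  have "((\<lambda>t. (T t x - x) /\<^sub>R t + (T t y - y) /\<^sub>R t) \<longlongrightarrow> A x + A y) (at_right 0)"
    using assms[THEN has_gen_generator] unfolding has_gen_def by (intro tendsto_add)
  moreover have "\<forall>\<^sub>F t in at_right 0. (T t x - x) /\<^sub>R t + (T t y - y) /\<^sub>R t = (T t (x + y) - (x + y)) /\<^sub>R t"
    using eventually_at_right_less[of "0::real"]
    by eventually_elim (simp add: T_add algebra_simps)
  ultimately have "has_gen T (x + y) (A x + A y)"
    unfolding has_gen_def by (rule Lim_transform_eventually)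
  from has_genD[OF this] show "x + y \<in> D" "A (x + y) = A x + A y" by auto
qed

lemma
  assumes "x \<in> D" "y \<in> D"
  shows diff_in_D: "x - y \<in> D" and A_diff: "A (x - y) = A x - A y"
  using add_in_D[OF assms(1) scaleR_in_D[OF assms(2), of "-1"]]
    A_add[OF assms(1) scaleR_in_D[OF assms(2), of "-1"]] A_scaleR[OF assms(2), of "-1"] by simp_all

text \<open>On the half line the orbit equals \<open>x + J t (A x)\<close>, whose derivative is
  already known.\<close>

lemma T_has_vector_derivative:
  assumes "x \<in> D" "t \<ge> 0"
  shows "((\<lambda>t. T t x) has_vector_derivative T t (A x)) (at t within {0..})"
proof (rule has_vector_derivative_transform)
  show "((\<lambda>t. x + J t (A x)) has_vector_derivative T t (A x)) (at t within {0..})"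
    using has_vector_derivative_add[OF has_vector_derivative_const J_has_vector_derivative[OF assms(2)]]
    by simp
qed (use assms in \<open>auto simp: J_A\<close>)

section \<open>Domains of powers of the generator\<close>

lemma Dn_scaleR: "x \<in> Dn n \<Longrightarrow> r *\<^sub>R x \<in> Dn n"
  by (induction n arbitrary: x) (auto simp: scaleR_in_D A_scaleR)

lemma Dn_add: "x \<in> Dn n \<Longrightarrow> y \<in> Dn n \<Longrightarrow> x + y \<in> Dn n"
  by (induction n arbitrary: x y) (auto simp: add_in_D A_add)

lemma Dn_diff: "x \<in> Dn n \<Longrightarrow> y \<in> Dn n \<Longrightarrow> x - y \<in> Dn n"
  by (induction n arbitrary: x y) (auto simp: diff_in_D A_diff)

lemma Dn_Suc: "x \<in> Dn (Suc n) \<Longrightarrow> x \<in> Dn n"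
  by (induction n arbitrary: x) auto

lemma T_Dn: "x \<in> Dn n \<Longrightarrow> t \<ge> 0 \<Longrightarrow> T t x \<in> Dn n"
  by (induction n arbitrary: x) (auto simp: T_in_D A_T)

text \<open>Integration gains one power of the domain: \<open>J \<tau>\<close> maps into
  \<open>D\<close>, and it commutes with \<open>A\<close> on \<open>D\<close>.\<close>

lemma J_Dn: "x \<in> Dn n \<Longrightarrow> \<tau> \<ge> 0 \<Longrightarrow> J \<tau> x \<in> Dn (Suc n)"
proof (induction n arbitrary: x)
  case 0
  then show ?case using has_genD[OF has_gen_J] by simp
next
  case (Suc n)
  then have "x \<in> D" "A x \<in> Dn n" by auto
  have "A (J \<tau> x) = J \<tau> (A x)"
    using has_genD(2)[OF has_gen_J] J_A[OF \<open>x \<in> D\<close>] Suc.prems by simp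
  with Suc.IH[OF \<open>A x \<in> Dn n\<close>] has_genD(1)[OF has_gen_J] Suc.prems
  show ?case by (subst power_domain.simps) simp
qed

text \<open>The averages of the orbit of \<open>y\<close> over \<open>{0..h}\<close> tend to
  \<open>y\<close> as \<open>h\<close> tends to 0 and lie one domain deeper than
  \<open>y\<close>.\<close>

lemma Dn_dense: "e > 0 \<Longrightarrow> \<exists>y \<in> Dn n. dist y x < e"
proof (induction n arbitrary: x e)
  case 0
  then show ?case by (intro bexI[of _ x]) auto
next
  case (Suc n)
  obtain y where y: "y \<in> Dn n" "dist y x < e / 2" using Suc.IH[of "e / 2" x] Suc.prems by auto
  have "((\<lambda>h. (J (0 + h) y - J 0 y) /\<^sub>R h) \<longlongrightarrow> T 0 y) (at_right 0)"
    by (intro has_vector_derivative_tendsto_at_right_0 J_has_vector_derivative) auto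
  then have "\<forall>\<^sub>F h in at_right 0. dist (J h y /\<^sub>R h) y < e / 2"
    using Suc.prems by (intro tendstoD) auto
  then have "\<forall>\<^sub>F h in at_right 0. dist (J h y /\<^sub>R h) y < e / 2 \<and> (0::real) < h"
    using eventually_at_right_less[of "0::real"] by (rule eventually_conj)
  then obtain h where h: "h > 0" "dist (J h y /\<^sub>R h) y < e / 2"
    using eventually_happens'[OF trivial_limit_at_right_real] by blast
  have "J h y /\<^sub>R h \<in> Dn (Suc n)"
    using J_Dn[OF y(1)] h by (intro Dn_scaleR) auto
  moreover have "dist (J h y /\<^sub>R h) x < e"
    using h(2) y(2) dist_triangle_less_add[of "J h y /\<^sub>R h" y "e / 2" x "e / 2"]
    by (simp add: dist_commute)
  ultimately show ?case by blast
qed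

end

section \<open>Rescaling and the resolvent at 1\<close>

lemma (in c0_semigroup) rescaled: "c0_semigroup (\<lambda>t x. exp (c * t) *\<^sub>R T t x)"
proof
  have 1: "bounded_clinear (\<lambda>x. exp (c * t) *\<^sub>R T t x)" if "t \<ge> 0" for t
    unfolding bounded_clinear_def
  proof (intro conjI allI)
    show "bounded_linear (\<lambda>x. exp (c * t) *\<^sub>R T t x)"
      by (intro bounded_linear_const_scaleR bounded_linear_T that)
  qed (simp add: that T_scaleC scaleC_scaleC mult.commute flip: scaleC_of_real)
  have "((\<lambda>t. exp (c * t)) \<longlongrightarrow> exp (c * 0)) (at_right 0)"
    by (intro tendsto_intros)
  then have 2: "((\<lambda>t. exp (c * t) *\<^sub>R T t x) \<longlongrightarrow> exp (c * 0) *\<^sub>R x) (at_right 0)" for x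
    by (intro tendsto_scaleR T_tendsto_0)
  show "C0_semigroup (\<lambda>t x. exp (c * t) *\<^sub>R T t x)"
    unfolding C0_semigroup_def
    using 1 2 by (auto simp: fun_eq_iff T_plus T_scaleR distrib_left exp_add mult.commute)
qed

lemma resolvent_properties:
  assumes "cogenerator_exists T"
  defines "R \<equiv> resolvent (gen_domain T) (generator T) 1"
  shows "R y \<in> gen_domain T" "generator T (R y) - R y = y"
    "x \<in> gen_domain T \<Longrightarrow> R (generator T x - x) = x" "bounded_clinear R"
proof -
  have bij: "bij_betw (\<lambda>x. generator T x - x) (gen_domain T) UNIV" and "bounded_clinear R"
    using assms by (auto simp: cogenerator_exists_def resolvent_set_def scaleC_one)
  have R: "R = the_inv_into (gen_domain T) (\<lambda>x. generator T x - x)"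
    by (simp add: R_def resolvent_def scaleC_one)
  show "generator T (R y) - R y = y"
    unfolding R using f_the_inv_into_f_bij_betw[OF bij, of y] by simp
  show "R y \<in> gen_domain T"
    unfolding R using bij by (auto simp: bij_betw_def intro: the_inv_into_into)
  show "x \<in> gen_domain T \<Longrightarrow> R (generator T x - x) = x"
    unfolding R using bij the_inv_into_f_f[of "\<lambda>x. generator T x - x" "gen_domain T" x]
    by (simp add: bij_betw_def)
  show "bounded_clinear R" by fact
qed

text \<open>For the rescaled semigroup \<open>S t = exp (- t) T t\<close> one has
  \<open>(A - 1) (J \<tau> x) = S \<tau> x - x\<close> with \<open>J \<tau> x\<close> the integral of \<open>S t x\<close> over \<open>{0..\<tau>}\<close>, so it is enough
  to invert \<open>S \<tau> - 1\<close>; this avoids the Laplace transform on the half line.\<close>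

lemma (in c0_semigroup) cogenerator_exists_if_contraction:
  assumes "\<tau> \<ge> 0" "0 \<le> q" "q < 1" and contr: "\<And>x. exp (- \<tau>) * norm (T \<tau> x) \<le> q * norm x"
  shows "cogenerator_exists T"
proof -
  define S where "S t x = exp (- 1 * t) *\<^sub>R T t x" for t x
  interpret S: c0_semigroup S
    unfolding S_def by (rule rescaled)
  have S_le: "norm (S \<tau> x) \<le> q * norm x" for x
    using contr[of x] by (simp add: S_def)
  have T_S: "T = (\<lambda>t x. exp (1 * t) *\<^sub>R S t x)"
    by (auto simp: S_def fun_eq_iff simp flip: exp_add)
  have SD: "x \<in> S.D" "S.A x = A x - x" if "x \<in> D" for x
    using has_genD[OF has_gen_rescale[OF has_gen_generator[OF that], of "-1"]]
    by (simp_all add: S_def[abs_def])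
  have TD: "x \<in> D" "A x = S.A x + x" if "x \<in> S.D" for x
    using has_genD[OF has_gen_rescale[OF has_gen_generator[OF that], of 1]]
    by (simp_all add: T_S)
  have J_left: "S.J \<tau> (A x - x) = S \<tau> x - x" if "x \<in> D" for x
    using S.J_A[of x \<tau>] SD[OF that] assms by simp
  have J_right: "S.J \<tau> x \<in> D" "A (S.J \<tau> x) - S.J \<tau> x = S \<tau> x - x" for x
    using has_genD[OF S.has_gen_J[OF assms(1), of x]] TD by auto
  have eq_0: "x = 0" if "S \<tau> x = x" for x
    using S_le[of x] that assms mult_less_cancel_right2[of q "norm x"] by auto
  \<comment> \<open>If \<open>(A - 1) u = 0\<close>, then \<open>J_left\<close> gives
    \<open>S \<tau> u = u\<close>, and a strict contraction fixes only 0.\<close>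
  have inj: "inj_on (\<lambda>x. A x - x) D"
  proof (rule inj_onI)
    fix x y assume xy: "x \<in> D" "y \<in> D" "A x - x = A y - y"
    have "x - y \<in> D" using xy by (simp add: diff_in_D)
    moreover have "A (x - y) - (x - y) = 0"
      using xy by (simp add: A_diff algebra_simps)
    ultimately have "S \<tau> (x - y) - (x - y) = 0"
      using J_left S.bounded_linear_J[OF assms(1), THEN bounded_linear.linear, THEN linear_0] by metis
    then show "x = y" using eq_0[of "x - y"] by simp
  qed
  \<comment> \<open>A fixed point \<open>z\<close> of the contraction
    \<open>z \<mapsto> S \<tau> z - y\<close> satisfies \<open>S \<tau> z - z = y\<close>, so the
    orbit integral of \<open>z\<close> is a preimage of \<open>y\<close>.\<close>
  have surj: "\<exists>x\<in>D. A x - x = y" for y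
  proof -
    have "dist (S \<tau> u - y) (S \<tau> v - y) \<le> q * dist u v" for u v
      using S_le[of "u - v"] assms by (simp add: dist_norm S.T_diff)
    then obtain z where "S \<tau> z - y = z"
      using banach_fix_type[of q "\<lambda>z. S \<tau> z - y"] assms by auto
    then show ?thesis
      using J_right[of z] by (intro bexI[of _ "S.J \<tau> z"]) (auto simp: algebra_simps)
  qed
  define R where "R = resolvent D A 1"
  have R: "R = the_inv_into D (\<lambda>x. A x - x)"
    by (simp add: R_def resolvent_def scaleC_one)
  have "y \<in> (\<lambda>x. A x - x) ` D" for y using surj[of y] by auto
  then have bij: "bij_betw (\<lambda>x. A x - x) D UNIV"
    using inj by (auto simp: bij_betw_def)
  have R1: "R y \<in> D" "A (R y) - R y = y" for y
    unfolding R using f_the_inv_into_f_bij_betw[OF bij, of y] bij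
    by (auto simp: bij_betw_def intro: the_inv_into_into)
  have R2: "R y = x" if "x \<in> D" "A x - x = y" for x y
    using inj_onD[OF inj, of "R y" x] R1[of y] that by simp
  have R_scaleC: "R (c *\<^sub>C x) = c *\<^sub>C R x" for c x
  proof (rule R2)
    show "A (c *\<^sub>C R x) - c *\<^sub>C R x = c *\<^sub>C x"
      using bounded_linear_scaleC[of c, THEN bounded_linear.linear, THEN linear_diff, of "A (R x)" "R x"]
      by (simp add: A_scaleC R1)
  qed (simp add: scaleC_in_D R1)
  obtain B where B: "\<And>x. norm (S.J \<tau> x) \<le> norm x * B"
    using bounded_linear.bounded[OF S.bounded_linear_J[OF assms(1)]] by blast
  have "bounded_linear R"
  \<comment> \<open>The constant comes from \<open>R x = S \<tau> (R x) - S.J \<tau> x\<close>,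
    which gives \<open>(1 - q) * norm (R x) \<le> norm x * B\<close>.\<close>
  proof (rule bounded_linear_intro[of _ "B / (1 - q)"])
    fix x y r
    show "R (x + y) = R x + R y"
      using R1[of x] R1[of y] by (intro R2) (auto simp: add_in_D A_add algebra_simps)
    show "R (r *\<^sub>R x) = r *\<^sub>R R x"
      using R_scaleC[of "of_real r" x] by (simp add: scaleC_of_real)
    have "R x = S \<tau> (R x) - S.J \<tau> x"
      using J_left[of "R x"] R1[of x] by simp
    then have "norm (R x) \<le> norm (S \<tau> (R x)) + norm (S.J \<tau> x)"
      by (metis norm_triangle_ineq4)
    also have "\<dots> \<le> q * norm (R x) + norm x * B"
      by (intro add_mono S_le B)
    finally show "norm (R x) \<le> norm x * (B / (1 - q))"
      using assms by (simp add: field_simps)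
  qed
  then have "bounded_clinear R" by (simp add: bounded_clinear_def R_scaleC)
  then show ?thesis
    using bij by (simp add: cogenerator_exists_def resolvent_set_def scaleC_one R_def)
qed

section \<open>Iterated sesquilinear forms\<close>

text \<open>For \<open>b = cinner\<close> this is the form in (iii). The recursion is the Leibniz rule.\<close>

primrec sesq :: "('a \<Rightarrow> 'a \<Rightarrow> complex) \<Rightarrow> ('a \<Rightarrow> 'a) \<Rightarrow> nat \<Rightarrow> 'a \<Rightarrow> 'a \<Rightarrow> complex" where
  "sesq b A 0 u v = b u v"
| "sesq b A (Suc m) u v = sesq b A m (A u) v + sesq b A m u (A v)"

lemma sesq_eq_sum:
  "sesq b A m u v = (\<Sum>k\<le>m. of_nat (m choose k) * b ((A ^^ (m - k)) u) ((A ^^ k) v))"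
proof (induction m arbitrary: u v)
  case (Suc m)
  have shift: "(A ^^ k) (A w) = (A ^^ Suc k) w" for k w
    by (simp add: funpow_swap1)
  show ?case
    unfolding sum_binomial_Suc[of m "\<lambda>k j. b ((A ^^ j) u) ((A ^^ k) v)"] sesq.simps Suc shift
    by (rule add.commute)
qed simp

definition isometry_defect :: "('a::real_normed_vector \<Rightarrow> 'a) \<Rightarrow> nat \<Rightarrow> 'a \<Rightarrow> real"
  where "isometry_defect V m x =
    (\<Sum>k\<le>m. of_nat (m choose k) * (-1) ^ (m - k) * (norm ((V ^^ k) x))\<^sup>2)"

lemma isometry_defect_0 [simp]: "isometry_defect V 0 x = (norm x)\<^sup>2"
  by (simp add: isometry_defect_def)

lemma isometry_defect_Suc:
  "isometry_defect V (Suc m) x = isometry_defect V m (V x) - isometry_defect V m x"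
proof -
  have shift: "(V ^^ k) (V w) = (V ^^ Suc k) w" for k w
    by (simp add: funpow_swap1)
  show ?thesis
    unfolding isometry_defect_def mult.assoc shift
      sum_binomial_Suc[of m "\<lambda>k j. (-1) ^ j * (norm ((V ^^ k) x))\<^sup>2"]
    by (simp add: sum_negf)
qed

lemma m_isometry_iff_defect:
  "m_isometry m V \<longleftrightarrow> bounded_clinear V \<and> (\<forall>x. isometry_defect V m x = 0)"
  by (simp add: m_isometry_def isometry_defect_def)

lemma fdiff_of_real: "fdiff h m (\<lambda>t. of_real (f t)) t = (of_real (fdiff h m f t) :: complex)"
  by (induction m arbitrary: t) auto

section \<open>Semigroups of m-isometries\<close>

context c0_semigroup
begin

lemma Dn_mono: "x \<in> Dn n \<Longrightarrow> k \<le> n \<Longrightarrow> x \<in> Dn k"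
proof (induction n)
  case (Suc n)
  then show ?case using Dn_Suc[of x n] by (cases "k = Suc n") auto
qed simp

section \<open>Derivatives and differences of squared norms along orbits\<close>

abbreviation orbit_form :: "real \<Rightarrow> 'a \<Rightarrow> 'a \<Rightarrow> complex"
  where "orbit_form t u v \<equiv> cinner (T t u) (T t v)"

text \<open>Only the base case differentiates an inner product; each later step adds the two terms
  of the recursion for \<open>sesq\<close>.\<close>

lemma orbit_form_has_vector_derivative:
  assumes "u \<in> Dn (Suc j)" "v \<in> Dn (Suc j)" "t \<ge> 0"
  shows "((\<lambda>t. sesq (orbit_form t) A j u v) has_vector_derivative sesq (orbit_form t) A (Suc j) u v)
    (at t within {0..})"
  using assms(1,2)
proof (induction j arbitrary: u v)
  case 0
  then show ?case
    using bounded_bilinear.has_vector_derivative[OF bounded_bilinear_cinner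
        T_has_vector_derivative[of u t] T_has_vector_derivative[of v t]] assms(3)
    by (simp add: add.commute)
next
  case (Suc j)
  have u: "u \<in> Dn (Suc j)" "A u \<in> Dn (Suc j)" and v: "v \<in> Dn (Suc j)" "A v \<in> Dn (Suc j)"
    using Suc.prems Dn_Suc[of u "Suc j"] Dn_Suc[of v "Suc j"] by simp_all
  show ?case
    using has_vector_derivative_add[OF Suc.IH[OF u(2) v(1)] Suc.IH[OF u(1) v(2)]] by simp
qed

lemma sesq_T:
  assumes "t \<ge> 0"
  shows "u \<in> Dn m \<Longrightarrow> v \<in> Dn m \<Longrightarrow> sesq cinner A m (T t u) (T t v) = sesq (orbit_form t) A m u v"
proof (induction m arbitrary: u v)
  case (Suc m)
  then show ?case using Dn_Suc[of u m] Dn_Suc[of v m] by (simp add: A_T assms)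
qed simp

lemma isometry_defect_T:
  assumes "h \<ge> 0"
  shows "isometry_defect (T h) m x = fdiff h m (\<lambda>t. (norm (T t x))\<^sup>2) 0"
  by (simp add: isometry_defect_def fdiff_eq_sum T_funpow assms)

text \<open>The isometry defect is a difference at 0. A difference at \<open>t\<close> becomes one
  at 0 when the orbit is started at \<open>T t x\<close>.\<close>

lemma fdiff_orbit_shift:
  assumes "h \<ge> 0" "t \<ge> 0"
  shows "fdiff h m (\<lambda>t. (norm (T t x))\<^sup>2) t = fdiff h m (\<lambda>s. (norm (T s (T t x)))\<^sup>2) 0"
  using assms by (simp add: fdiff_eq_sum T_plus)

section \<open>Equivalence of (i), (ii) and (iii)\<close>

lemma poly_norm_if_m_isometry:
  assumes "m > 0" and iso: "\<And>t. t \<ge> 0 \<Longrightarrow> m_isometry m (T t)"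
  shows "\<exists>p :: real poly. degree p < m \<and> (\<forall>t\<ge>0. (norm (T t x))\<^sup>2 = poly p t)"
proof (rule zero_fdiff_imp_poly[OF _ \<open>m > 0\<close>])
  show "fdiff h m (\<lambda>t. (norm (T t x))\<^sup>2) t = 0" if "h \<ge> 0" "t \<ge> 0" for h t
    unfolding fdiff_orbit_shift[OF that] isometry_defect_T[OF that(1), symmetric]
    using iso[OF that(1)] by (simp add: m_isometry_iff_defect)
  show "continuous (at_right t) (\<lambda>t. (norm (T t x))\<^sup>2)" if "t \<ge> 0" for t
  proof -
    have "continuous (at t within {0..}) (\<lambda>t. T t x)"
      using continuous_T that by (auto simp: continuous_on_eq_continuous_within)
    then have "continuous (at_right t) (\<lambda>t. T t x)"
      by (rule continuous_within_subset) (use that in auto)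
    then show ?thesis by (intro continuous_intros)
  qed
qed

lemma m_isometry_if_poly_norm:
  assumes p: "\<And>x. \<exists>p :: real poly. degree p < m \<and> (\<forall>t\<ge>0. (norm (T t x))\<^sup>2 = poly p t)" and "h \<ge> 0"
  shows "m_isometry m (T h)"
proof -
  have "isometry_defect (T h) m x = 0" for x
  proof -
    obtain p :: "real poly" where p: "degree p < m" "\<And>t. t \<ge> 0 \<Longrightarrow> (norm (T t x))\<^sup>2 = poly p t"
      using p by blast
    have "isometry_defect (T h) m x = fdiff h m (poly p) 0"
      using \<open>h \<ge> 0\<close> by (simp add: isometry_defect_T fdiff_eq_sum p(2))
    with p(1) \<open>h \<ge> 0\<close> show ?thesis by (simp add: fdiff_poly_eq_0)
  qed
  then show ?thesis
    using C0 \<open>h \<ge> 0\<close> by (simp add: m_isometry_iff_defect C0_semigroup_def)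
qed

text \<open>The successive right derivatives of the squared norm are computed in two ways, through
  the forms and through \<open>p\<close>; one-sided limits are unique, and the \<open>m\<close>-th
  derivative of \<open>p\<close> is zero.\<close>

lemma sesq_eq_0_if_poly_norm:
  assumes x: "x \<in> Dn m" and p: "degree p < m" "\<And>t. t \<ge> 0 \<Longrightarrow> (norm (T t x))\<^sup>2 = poly p t"
  shows "sesq cinner A m x x = 0"
proof -
  have "j \<le> m \<Longrightarrow> t \<ge> 0 \<Longrightarrow> sesq (orbit_form t) A j x x = of_real (poly ((pderiv ^^ j) p) t)" for j t
  proof (induction j arbitrary: t)
    case 0
    then show ?case by (simp add: cinner_self p(2) del: of_real_power)
  next
    case (Suc j)
    have "x \<in> Dn (Suc j)" using Suc.prems(1) by (rule Dn_mono[OF x])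
    note deriv = orbit_form_has_vector_derivative[OF this this \<open>t \<ge> 0\<close>]
    have "((\<lambda>t. of_real (poly ((pderiv ^^ j) p) t) :: complex) has_vector_derivative
        of_real (poly ((pderiv ^^ Suc j) p) t)) (at t within {0..})"
      using poly_DERIV[of "(pderiv ^^ j) p" t]
      by (intro has_vector_derivative_of_real)
        (simp add: has_real_derivative_iff_has_vector_derivative has_vector_derivative_at_within)
    then have "((\<lambda>t. sesq (orbit_form t) A j x x) has_vector_derivative
        of_real (poly ((pderiv ^^ Suc j) p) t)) (at t within {0..})"
      by (rule has_vector_derivative_transform[rotated 2]) (use Suc in auto)
    from tendsto_unique[OF trivial_limit_at_right_real
        has_vector_derivative_tendsto_at_right_0[OF deriv \<open>t \<ge> 0\<close>]
        has_vector_derivative_tendsto_at_right_0[OF this \<open>t \<ge> 0\<close>]]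
    show ?case .
  qed
  from this[of m 0] show ?thesis
    using p(1) sesq_T[of 0 x m x] x by (simp add: funpow_pderiv_eq_0)
qed

text \<open>Since \<open>T t\<close> preserves \<open>Dn m\<close>, the hypothesis at
  \<open>T t x\<close> makes the \<open>m\<close>-th derivative of the squared norm vanish at every
  time, which settles \<open>x\<close> in \<open>Dn m\<close>. The rest follows by density.\<close>

lemma m_isometry_if_sesq_eq_0:
  assumes sesq: "\<And>x. x \<in> Dn m \<Longrightarrow> sesq cinner A m x x = 0" and "h \<ge> 0"
  shows "m_isometry m (T h)"
proof -
  have Dn: "isometry_defect (T h) m x = 0" if x: "x \<in> Dn m" for x
  proof -
    have "fdiff h m (\<lambda>t. sesq (orbit_form t) A 0 x x) 0 = 0"
    proof (rule fdiff_eq_0_of_chain[where g = "\<lambda>j t. sesq (orbit_form t) A j x x"])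
      show "((\<lambda>t. sesq (orbit_form t) A j x x) has_vector_derivative sesq (orbit_form t) A (Suc j) x x)
          (at t within {0..})" if "j < m" "t \<ge> 0" for j t
        using that Dn_mono[OF x Suc_leI] by (intro orbit_form_has_vector_derivative)
      show "sesq (orbit_form t) A m x x = 0" if "t \<ge> 0" for t
        using sesq[OF T_Dn[OF x that]] sesq_T[OF that x x] by simp
    qed (use \<open>h \<ge> 0\<close> in auto)
    then show ?thesis
      using \<open>h \<ge> 0\<close> by (simp add: cinner_self isometry_defect_T fdiff_of_real del: of_real_power)
  qed
  \<comment> \<open>For fixed \<open>h\<close> the defect is continuous in the vector, so its zero
    set is closed and contains the closure of \<open>Dn m\<close>.\<close>
  have "continuous_on UNIV (T (real k * h))" for k
    using \<open>h \<ge> 0\<close> by (intro linear_continuous_on bounded_linear_T) simp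
  then have "continuous_on UNIV (isometry_defect (T h) m)"
    unfolding isometry_defect_def[abs_def] T_funpow[OF \<open>h \<ge> 0\<close>] by (intro continuous_intros)
  then have "closed {x. isometry_defect (T h) m x = 0}"
    by (intro closed_Collect_eq continuous_on_const)
  moreover have "Dn m \<subseteq> {x. isometry_defect (T h) m x = 0}" using Dn by auto
  ultimately have "closure (Dn m) \<subseteq> {x. isometry_defect (T h) m x = 0}" by (rule closure_minimal[rotated])
  moreover have "x \<in> closure (Dn m)" for x
    using Dn_dense unfolding closure_approachable by blast
  ultimately have "isometry_defect (T h) m x = 0" for x by blast
  then show ?thesis
    using C0 \<open>h \<ge> 0\<close> by (simp add: m_isometry_iff_defect C0_semigroup_def)
qed

text \<open>The polynomial depends on \<open>x\<close>, so its growth gives only pointwise bounds;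
  uniform boundedness turns them into an operator bound, and a large time yields the contraction
  required for inverting \<open>A - 1\<close>.\<close>

lemma cogenerator_exists_if_poly_norm:
  assumes p: "\<And>x. \<exists>p :: real poly. \<forall>t\<ge>0. (norm (T t x))\<^sup>2 = poly p t"
  shows "cogenerator_exists T"
proof -
  \<comment> \<open>Half of the decay \<open>exp (- n)\<close> is spent on bounding the orbits,
    where squaring restores \<open>exp n\<close> in the denominator; the other half later makes
    \<open>q\<close> smaller than 1.\<close>
  define F where "F n x = exp (- (real n / 2)) *\<^sub>R T (real n) x" for n x
  have lin: "bounded_linear (F n)" for n
    unfolding F_def[abs_def] by (intro bounded_linear_const_scaleR bounded_linear_T) simp
  have "\<exists>B. \<forall>n. norm (F n x) \<le> B" for x
  proof -
    obtain p :: "real poly" where p: "\<And>t. t \<ge> 0 \<Longrightarrow> (norm (T t x))\<^sup>2 = poly p t"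
      using p by blast
    have "(norm (F n x))\<^sup>2 = poly p (real n) / exp (real n)" for n
      using p[of "real n"]
      by (simp add: F_def power_mult_distrib exp_minus field_simps flip: exp_double)
    moreover have "(\<lambda>n. poly p (real n) / exp (real n)) \<longlonglongrightarrow> 0"
      using filterlim_compose[OF poly_over_exp_tendsto_0 filterlim_real_sequentially] .
    ultimately have "Bseq (\<lambda>n. (norm (F n x))\<^sup>2)"
      by (intro convergent_imp_Bseq convergentI) simp
    then obtain B where B: "\<And>n. (norm (F n x))\<^sup>2 \<le> B" by (auto simp: Bseq_def)
    \<comment> \<open>From \<open>(a - 1)^2 \<ge> 0\<close> one gets
      \<open>2 * a \<le> a^2 + 1\<close>, a bound on the norm without a square root.\<close>
    have "norm (F n x) \<le> B + 1" for n
    proof -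
      have "0 \<le> (norm (F n x))\<^sup>2 - 2 * norm (F n x) + 1"
        using zero_le_power2[of "norm (F n x) - 1"] by (simp add: power2_diff)
      with B[of n] zero_le_power2[of "norm (F n x)"] show ?thesis by linarith
    qed
    then show ?thesis by blast
  qed
  with lin obtain M where M: "M > 0" "\<And>n x. norm (F n x) \<le> M * norm x"
    using uniform_boundedness[of F] by metis
  \<comment> \<open>This choice gives \<open>exp (n / 2) \<ge> 1 + n / 2 > M\<close>.\<close>
  obtain n where "2 * M \<le> real n" using real_arch_simple by blast
  define q where "q = exp (- (real n / 2)) * M"
  have "M < exp (real n / 2)"
    using exp_ge_add_one_self[of "real n / 2"] \<open>2 * M \<le> real n\<close> by linarith
  then have "q < 1" by (simp add: q_def exp_minus field_simps)
  have "exp (- real n) * norm (T (real n) x) \<le> q * norm x" for x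
  proof -
    have "exp (- real n) * norm (T (real n) x) = exp (- (real n / 2)) * norm (F n x)"
      by (simp add: F_def mult.assoc[symmetric] flip: exp_add)
    also have "\<dots> \<le> exp (- (real n / 2)) * (M * norm x)"
      by (intro mult_left_mono M) simp
    finally show ?thesis by (simp add: q_def mult.assoc)
  qed
  then show ?thesis
    using \<open>q < 1\<close> M(1) by (intro cogenerator_exists_if_contraction[of "real n" q]) (auto simp: q_def)
qed

section \<open>The operator A - 1 and the defect of the cogenerator\<close>

definition Q :: "'a \<Rightarrow> 'a" where "Q x = A x - x"

lemma Q_Dn: "x \<in> Dn (Suc n) \<Longrightarrow> Q x \<in> Dn n"
  unfolding Q_def using Dn_Suc[of x n] by (intro Dn_diff) auto

lemma Q_funpow_add: "x \<in> Dn n \<Longrightarrow> y \<in> Dn n \<Longrightarrow> (Q ^^ n) (x + y) = (Q ^^ n) x + (Q ^^ n) y"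
proof (induction n arbitrary: x y)
  case (Suc n)
  have "Q (x + y) = Q x + Q y"
    using Suc.prems by (simp add: Q_def A_add)
  then show ?case
    using Suc.IH[of "Q x" "Q y"] Suc.prems Q_Dn[of x n] Q_Dn[of y n]
    by (simp add: funpow_Suc_right del: funpow.simps power_domain.simps)
qed simp

lemma Q_funpow_Dn: "x \<in> Dn (n + k) \<Longrightarrow> (Q ^^ n) x \<in> Dn k"
proof (induction n arbitrary: x)
  case (Suc n)
  then show ?case
    using Q_Dn[of x "n + k"] by (simp add: funpow_Suc_right del: funpow.simps power_domain.simps)
qed simp

lemma sesq_bilinear:
  assumes "x \<in> Dn m" "y \<in> Dn m"
  shows "sesq cinner A m (x + y) v = sesq cinner A m x v + sesq cinner A m y v"
    and "sesq cinner A m (x - y) v = sesq cinner A m x v - sesq cinner A m y v"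
    and "sesq cinner A m v (x + y) = sesq cinner A m v x + sesq cinner A m v y"
    and "sesq cinner A m v (x - y) = sesq cinner A m v x - sesq cinner A m v y"
  using assms
proof (induction m arbitrary: x y v)
  case 0
  {
    case 2
    show ?case using cinner_add_left[of "x - y" y v] by simp
  next
    case 4
    show ?case using cinner_add_right[of v "x - y" y] by simp
  }
next
  case (Suc m)
  {
    case 1
    then show ?case using Dn_Suc[of x m] Dn_Suc[of y m] by (simp add: Suc A_add)
  next
    case 2
    then show ?case using Dn_Suc[of x m] Dn_Suc[of y m] by (simp add: Suc A_diff)
  next
    case 3
    then show ?case using Dn_Suc[of x m] Dn_Suc[of y m] by (simp add: Suc A_add)
  next
    case 4
    then show ?case using Dn_Suc[of x m] Dn_Suc[of y m] by (simp add: Suc A_diff)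
  }
qed (simp_all add: cinner_add_left cinner_add_right)

text \<open>The diagonal terms cancel, and the cross terms that survive are twice the two Leibniz
  terms of the next form.\<close>

lemma sesq_polarization:
  assumes "A z \<in> Dn m" "z \<in> Dn m"
  shows "sesq cinner A m (A z + z) (A z + z) - sesq cinner A m (A z - z) (A z - z) =
    2 * sesq cinner A (Suc m) z z"
  using assms by (simp add: sesq_bilinear)

end

lemma cogenerator_generator_diff:
  assumes "cogenerator_exists T" "x \<in> gen_domain T"
  shows "cogenerator T (generator T x - x) = generator T x + x"
  using resolvent_properties(3)[OF assms] by (simp add: cogenerator_def Let_def)

lemma bounded_clinear_cogenerator:
  assumes "cogenerator_exists T"
  shows "bounded_clinear (cogenerator T)"
proof -
  have R: "bounded_clinear (resolvent (gen_domain T) (generator T) 1)"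
    by (rule resolvent_properties(4)[OF assms])
  have V: "cogenerator T = (\<lambda>y. y + 2 *\<^sub>R resolvent (gen_domain T) (generator T) 1 y)"
    using cogenerator_eq[OF assms] by auto
  have "2 *\<^sub>R c *\<^sub>C x = c *\<^sub>C (2 *\<^sub>R x)" for c and x :: 'a
    using linear_scale[OF bounded_linear.linear[OF bounded_linear_scaleC[of c]], of 2 x] by simp
  with R show ?thesis
    unfolding V bounded_clinear_def
    by (auto intro!: bounded_linear_intros simp: scaleC_add_right)
qed

text \<open>The identity behind the equivalence with (iv): with \<open>P = A + 1\<close> and \<open>Q = A - 1\<close>, the cogenerator
  sends \<open>Q\<close> to \<open>P\<close>, and \<open>(a + 1) (b + 1) - (a - 1) (b - 1) = 2 (a + b)\<close>.\<close>

lemma (in c0_semigroup) isometry_defect_cogenerator: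
  assumes "cogenerator_exists T"
  shows "z \<in> Dn m \<Longrightarrow>
    of_real (isometry_defect (cogenerator T) m ((Q ^^ m) z)) = 2 ^ m * sesq cinner A m z z"
proof (induction m arbitrary: z)
  case 0
  then show ?case by (simp add: cinner_self)
next
  case (Suc m)
  let ?V = "cogenerator T" and ?P = "A z + z" and ?w = "(Q ^^ m) z"
  have z: "z \<in> Dn m" "A z \<in> Dn m" using Suc.prems Dn_Suc[of z m] by auto
  have P: "?P \<in> Dn m" and Qz: "Q z \<in> Dn m"
    using z Q_Dn Suc.prems by (auto intro: Dn_add)
  have w: "?w \<in> D"
    using Q_funpow_Dn[of z m 1] Suc.prems by simp
  \<comment> \<open>Writing \<open>A z + z\<close> as \<open>Q z + (z + z)\<close> shows, by
    additivity alone, that \<open>Q ^^ m\<close> commutes with \<open>A + 1\<close>; the cogenerator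
    then sends \<open>Q ?w\<close> to this vector.\<close>
  have "(Q ^^ m) ?P = (Q ^^ m) (Q z + (z + z))"
    by (simp add: Q_def)
  also have "\<dots> = (Q ^^ m) (Q z) + (?w + ?w)"
    using z Qz by (simp add: Q_funpow_add Dn_add)
  also have "\<dots> = A ?w + ?w"
    by (simp only: funpow_swap1[symmetric]) (simp add: Q_def)
  also have "\<dots> = ?V (Q ?w)"
    using cogenerator_generator_diff[OF assms w] by (simp add: Q_def)
  finally have VQ: "?V (Q ?w) = (Q ^^ m) ?P" by simp
  have defect: "isometry_defect ?V (Suc m) ((Q ^^ Suc m) z) =
      isometry_defect ?V m ((Q ^^ m) ?P) - isometry_defect ?V m ((Q ^^ m) (Q z))"
    by (simp add: isometry_defect_Suc VQ) (simp add: funpow_swap1)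
  have "of_real (isometry_defect ?V (Suc m) ((Q ^^ Suc m) z)) =
      2 ^ m * (sesq cinner A m ?P ?P - sesq cinner A m (Q z) (Q z))"
    unfolding defect of_real_diff Suc.IH[OF P] Suc.IH[OF Qz] by (rule right_diff_distrib[symmetric])
  also have "\<dots> = 2 ^ Suc m * sesq cinner A (Suc m) z z"
    unfolding Q_def sesq_polarization[OF z(2,1)] power_Suc by (simp only: mult_ac)
  finally show ?case .
qed

text \<open>The resolvent is a right inverse of \<open>Q\<close>, and
  \<open>A (R u) = R u + u\<close> shows that it raises the domain power by one, so it can be
  iterated \<open>m\<close> times.\<close>

lemma (in c0_semigroup) Q_funpow_surj:
  assumes "cogenerator_exists T"
  shows "\<exists>z \<in> Dn m. (Q ^^ m) z = y"
proof (induction m)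
  case (Suc m)
  then obtain w where w: "w \<in> Dn m" "(Q ^^ m) w = y" by blast
  define R where "R = resolvent D A 1"
  have R: "R u \<in> D" "A (R u) = R u + u" for u
    using resolvent_properties(1,2)[OF assms, of u] by (auto simp: R_def algebra_simps)
  have "u \<in> Dn n \<Longrightarrow> R u \<in> Dn (Suc n)" for u n
  proof (induction n)
    case (Suc n)
    have "R u \<in> Dn (Suc n)" by (rule Suc.IH[OF Dn_Suc[OF Suc.prems]])
    then have "R u + u \<in> Dn (Suc n)" using Suc.prems by (rule Dn_add)
    then show ?case using R[of u] by (subst power_domain.simps) simp
  qed (simp add: R)
  then have "R w \<in> Dn (Suc m)" using w by blast
  moreover have "Q (R w) = w" by (simp add: Q_def R)
  ultimately show ?case
    using w by (intro bexI[of _ "R w"]) (auto simp: funpow_Suc_right simp del: funpow.simps)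
qed simp

text \<open>Every vector is \<open>(Q ^^ m) z\<close> for some \<open>z\<close> in
  \<open>Dn m\<close>, so the pointwise identity between defect and form covers the whole
  space.\<close>

lemma (in c0_semigroup) m_isometry_cogenerator_iff:
  assumes "cogenerator_exists T"
  shows "m_isometry m (cogenerator T) \<longleftrightarrow> (\<forall>x \<in> Dn m. sesq cinner A m x x = 0)"
proof -
  have "isometry_defect (cogenerator T) m ((Q ^^ m) z) = 0 \<longleftrightarrow> sesq cinner A m z z = 0" if "z \<in> Dn m" for z
    using isometry_defect_cogenerator[OF assms that]
    by (metis mult_eq_0_iff of_real_eq_0_iff power_not_zero zero_neq_numeral)
  then show ?thesis
    using Q_funpow_surj[OF assms] bounded_clinear_cogenerator[OF assms]
    unfolding m_isometry_iff_defect by metis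
qed

theorem theorem2p1:
  fixes T :: "real \<Rightarrow> 'a::complex_hilbert_space \<Rightarrow> 'a"
    and m :: nat
  assumes "m > 0"
    and "separable_space (euclidean :: 'a topology)"
    and "C0_semigroup T"
  shows "let A = generator T;
      cond_i = (\<forall>t\<ge>0. m_isometry m (T t));
      cond_ii = (\<forall>x. \<exists>p :: real poly. degree p < m \<and> (\<forall>t\<ge>0. (norm (T t x))\<^sup>2 = poly p t));
      cond_iii = (\<forall>x \<in> power_domain (gen_domain T) A m.
        (\<Sum>k\<le>m. of_nat (m choose k) * cinner ((A ^^ (m - k)) x) ((A ^^ k) x)) = 0);
      cond_iv = (cogenerator_exists T \<and> m_isometry m (cogenerator T))
    in (cond_i \<longleftrightarrow> cond_ii) \<and> (cond_ii \<longleftrightarrow> cond_iii) \<and> (cond_iii \<longleftrightarrow> cond_iv)"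
proof -
  interpret c0_semigroup T by standard (rule assms)
  let ?i = "\<forall>t\<ge>0. m_isometry m (T t)"
  let ?ii = "\<forall>x. \<exists>p :: real poly. degree p < m \<and> (\<forall>t\<ge>0. (norm (T t x))\<^sup>2 = poly p t)"
  let ?iii = "\<forall>x \<in> Dn m. sesq cinner A m x x = 0"
  let ?iv = "cogenerator_exists T \<and> m_isometry m (cogenerator T)"
  have "?i \<Longrightarrow> ?ii" using poly_norm_if_m_isometry[OF assms(1)] by blast
  moreover have "?ii \<Longrightarrow> ?i" using m_isometry_if_poly_norm by blast
  moreover have "?ii \<Longrightarrow> ?iii" using sesq_eq_0_if_poly_norm by blast
  moreover have "?iii \<Longrightarrow> ?i" using m_isometry_if_sesq_eq_0 by blast
  \<comment> \<open>Existence of the cogenerator is obtained from (ii) beforehand, because comparing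
    (iii) with the isometry property of the cogenerator presupposes it.\<close>
  moreover have "?ii \<Longrightarrow> cogenerator_exists T" using cogenerator_exists_if_poly_norm by blast
  moreover have "cogenerator_exists T \<Longrightarrow> m_isometry m (cogenerator T) \<longleftrightarrow> ?iii"
    by (rule m_isometry_cogenerator_iff)
  ultimately have "(?i \<longleftrightarrow> ?ii) \<and> (?ii \<longleftrightarrow> ?iii) \<and> (?iii \<longleftrightarrow> ?iv)" by argo
  then show ?thesis unfolding Let_def sesq_eq_sum .
qed

end
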